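(* Let $u\in\mathcal B$ be the unique fixed point of $\mathcal T$ in $\mathcal B$, and set $\theta_n=s_n+u_n$ and $p_n=P(\theta_n-\theta_{n-1})$ for $n\in\mathbb Z$. Then $\bigl((\theta_n \bmod \pi,\,p_n)\bigr)_{n\in\mathbb Z}$ is an orbit of $F_0$ and is a transverse heteroclinic connection from $X=(0,0)$ to $Y=(\pi/2,0)$ for $F_0$.
   Context: Map. Let $g(p)=2\bigl(\arcsin p-\arcsin(p/2)\bigr)$ for $|p|<1$. The map $F_0:(\theta,p)\mapsto(\theta_+,p_+)$ is $$p_+=p-16\sin(2\theta),\qquad \theta_+=\theta+g(p_+)\pmod\pi,$$ considered on $\mathcal D=\{(\theta,p)\in(\mathbb R/\pi\mathbb Z)\times\mathbb R:\ |p|<1,\ |p-16\sin(2\theta)|<1\}$, where it is a local diffeomorphism. The points $X=(0,0)$ and $Y=(\pi/2,0)$ are hyperbolic saddle fixed points of $F_0$. Inverse drift. $g$ maps $(-1,1)$ bijectively and increasingly onto $(-2\pi/3,2\pi/3)$, with inverse $$P(d)=\frac{\sin(d/2)}{\sqrt{\tfrac54-\cos(d/2)}}.$$ Fixed-point problem. Let $s_n=0$ for $n\le0$, $s_n=\pi/2$ for $n\ge1$, $\sigma_n=\cos(2s_n)\in\{1,-1\}$, and $\mathcal B=\{u\in\ell^\infty(\mathbb Z):\|u\|_\infty\le1/8\}$. For $u\in\mathcal B$ write $\theta_n=s_n+u_n$ (so that $|\theta_{n+1}-\theta_n|\le\frac\pi2+\frac14<\frac{2\pi}3$) and $$(\mathcal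 Tu)_n=\frac{\sigma_n}{2}\arcsin\left(\frac{P(\theta_n-\theta_{n-1})-P(\theta_{n+1}-\theta_n)}{16}\right),\qquad n\in\mathbb Z.$$ The map $\mathcal T$ is a contraction of $\mathcal B$ into itself, hence has a unique fixed point in $\mathcal B$. A transverse heteroclinic connection from $X$ to $Y$ is an orbit contained in $\mathcal D$, converging to $X$ as $n\to-\infty$ and to $Y$ as $n\to+\infty$, along which the invariant curves $W^u(X)$ and $W^s(Y)$ intersect with distinct tangent lines. *)

theory Defs
  imports "HOL-Analysis.Analysis"
begin

section \<open>The circle of length \<open>\<pi>\<close> and the cylinder\<close>

definition eq_mod_pi :: "real \<Rightarrow> real \<Rightarrow> bool" where
  "eq_mod_pi x y \<longleftrightarrow> (\<exists>k::int. x - y = of_int k * pi)"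

lemma equivp_eq_mod_pi: "equivp eq_mod_pi"
proof (rule equivpI)
  show "reflp eq_mod_pi"
    by (rule reflpI) (auto simp: eq_mod_pi_def intro: exI[of _ 0])
  show "symp eq_mod_pi"
  proof (rule sympI)
    fix x y assume "eq_mod_pi x y"
    then obtain k :: int where "x - y = of_int k * pi" by (auto simp: eq_mod_pi_def)
    then have "y - x = of_int (- k) * pi" by (simp add: algebra_simps)
    then show "eq_mod_pi y x" unfolding eq_mod_pi_def by blast
  qed
  show "transp eq_mod_pi"
  proof (rule transpI)
    fix x y z assume "eq_mod_pi x y" "eq_mod_pi y z"
    then obtain k l :: int where "x - y = of_int k * pi" "y - z = of_int l * pi"
      by (auto simp: eq_mod_pi_def)
    then have "x - z = of_int (k + l) * pi" by (simp add: algebra_simps)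
    then show "eq_mod_pi x z" unfolding eq_mod_pi_def by blast
  qed
qed

quotient_type circ = real / eq_mod_pi
  by (rule equivp_eq_mod_pi)

lift_definition circ_of :: "real \<Rightarrow> circ" is "\<lambda>x. x" .

instantiation circ :: topological_space
begin

definition open_circ :: "circ set \<Rightarrow> bool" where
  "open_circ U \<longleftrightarrow> open (circ_of -` U)"

instance
proof
  show "open (UNIV :: circ set)" by (simp add: open_circ_def)
  show "open (S \<inter> T)" if "open S" "open T" for S T :: "circ set"
    using that by (auto simp: open_circ_def vimage_Int)
  show "open (\<Union>K)" if "\<forall>S\<in>K. open S" for K :: "circ set set"
    using that by (auto simp: open_circ_def vimage_Union)
qed

end

type_synonym cyl = "circ \<times> real"

definition cyl_of :: "real \<times> real \<Rightarrow> cyl" where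
  "cyl_of z = (circ_of (fst z), snd z)"

lift_definition circ_sin2 :: "circ \<Rightarrow> real" is "\<lambda>x. sin (2 * x)"
proof -
  fix x y assume "eq_mod_pi x y"
  then obtain k :: int where "x - y = of_int k * pi" by (auto simp: eq_mod_pi_def)
  then have "2 * x = 2 * y + 2 * pi * of_int k" by (simp add: algebra_simps)
  then show "sin (2 * x) = sin (2 * y)" by (simp only: sin_add sin_int_2pin cos_int_2pin mult_1_right mult_zero_right add_0_right)
qed

lift_definition circ_shift :: "circ \<Rightarrow> real \<Rightarrow> circ" is "\<lambda>x d. x + d"
  by (simp add: eq_mod_pi_def)


section \<open>The map\<close>

definition drift :: "real \<Rightarrow> real" where
  "drift p = 2 * (arcsin p - arcsin (p / 2))"

definition kick :: "cyl \<Rightarrow> real" where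
  "kick z = snd z - 16 * circ_sin2 (fst z)"

text \<open>\<open>F0\<close> is total as a HOL function, but it is meaningful only on \<open>domF\<close>.\<close>

definition domF :: "cyl set" where
  "domF = {z. \<bar>snd z\<bar> < 1 \<and> \<bar>kick z\<bar> < 1}"

definition F0 :: "cyl \<Rightarrow> cyl" where
  "F0 z = (circ_shift (fst z) (drift (kick z)), kick z)"

definition saddle_X :: cyl where "saddle_X = cyl_of (0, 0)"
definition saddle_Y :: cyl where "saddle_Y = cyl_of (pi / 2, 0)"


section \<open>Invariant curves and their tangent lines\<close>

definition is_orbit :: "(int \<Rightarrow> cyl) \<Rightarrow> bool" where
  "is_orbit z \<longleftrightarrow> (\<forall>n. z n \<in> domF \<and> F0 (z n) = z (n + 1))"

definition forward_orbit :: "cyl \<Rightarrow> (nat \<Rightarrow> cyl) \<Rightarrow> bool" where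
  "forward_orbit z w \<longleftrightarrow> w 0 = z \<and> (\<forall>n. w n \<in> domF \<and> F0 (w n) = w (Suc n))"

definition backward_orbit :: "cyl \<Rightarrow> (nat \<Rightarrow> cyl) \<Rightarrow> bool" where
  "backward_orbit z w \<longleftrightarrow> w 0 = z \<and> (\<forall>n. w (Suc n) \<in> domF \<and> F0 (w (Suc n)) = w n)"

definition Wu :: "cyl \<Rightarrow> cyl set" where
  "Wu A = {z. \<exists>w. backward_orbit z w \<and> w \<longlonglongrightarrow> A}"

definition Ws :: "cyl \<Rightarrow> cyl set" where
  "Ws A = {z. \<exists>w. forward_orbit z w \<and> w \<longlonglongrightarrow> A}"

text \<open>
  The global invariant curves are only injectively immersed, and may accumulate on themselves. Their
  smooth structure comes from the local ones: for a neighbourhood \<open>U\<close> of \<open>A\<close>,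
  \<open>Wu_part A U 0\<close> is the local unstable set in \<open>U\<close>, and \<open>Wu_part A U N\<close> is
  its image under \<open>F0 ^^ N\<close> (where all the iterates are defined). These sets increase with \<open>N\<close>
  and exhaust \<open>Wu A\<close>. Likewise \<open>Ws_part A U N\<close> is the preimage of the local stable set
  under \<open>F0 ^^ N\<close>.
\<close>

definition Wu_part :: "cyl \<Rightarrow> cyl set \<Rightarrow> nat \<Rightarrow> cyl set" where
  "Wu_part A U N = {z. \<exists>w. backward_orbit z w \<and> w \<longlonglongrightarrow> A \<and> (\<forall>n\<ge>N. w n \<in> U)}"

definition Ws_part :: "cyl \<Rightarrow> cyl set \<Rightarrow> nat \<Rightarrow> cyl set" where
  "Ws_part A U N = {z. \<exists>w. forward_orbit z w \<and> w \<longlonglongrightarrow> A \<and> (\<forall>n\<ge>N. w n \<in> U)}"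

lemma Wu_eq_Union: "open U \<Longrightarrow> A \<in> U \<Longrightarrow> Wu A = (\<Union>N. Wu_part A U N)"
  unfolding Wu_def Wu_part_def
  using topological_tendstoD[of _ A sequentially U] by (fastforce simp: eventually_sequentially)

lemma Ws_eq_Union: "open U \<Longrightarrow> A \<in> U \<Longrightarrow> Ws A = (\<Union>N. Ws_part A U N)"
  unfolding Ws_def Ws_part_def
  using topological_tendstoD[of _ A sequentially U] by (fastforce simp: eventually_sequentially)

text \<open>
  Near \<open>z\<close> the set \<open>S\<close> is an embedded \<open>C\<^sup>1\<close> curve with tangent line \<open>L\<close> at \<open>z\<close>.
  The parametrization \<open>\<gamma>\<close> takes values in the universal cover \<open>\<real>\<^sup>2\<close> of the cylinder. Tangent
  spaces of the cylinder are identified with \<open>\<real>\<^sup>2\<close> through the covering map \<^term>\<open>cyl_of\<close>; the choice of lift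
  does not matter, because deck transformations are translations.
\<close>

definition embedded_curve_tangent :: "cyl set \<Rightarrow> cyl \<Rightarrow> (real \<times> real) set \<Rightarrow> bool" where
  "embedded_curve_tangent S z L \<longleftrightarrow>
     (\<exists>V \<gamma> \<gamma>' h. open V \<and> z \<in> V \<and>
        homeomorphism {-1<..<1} (S \<inter> V) (\<lambda>t::real. cyl_of (\<gamma> t)) h \<and>
        (\<forall>t\<in>{-1<..<1}. (\<gamma> has_vector_derivative \<gamma>' t) (at t) \<and> \<gamma>' t \<noteq> 0) \<and>
        continuous_on {-1<..<1} \<gamma>' \<and>
        cyl_of (\<gamma> 0) = z \<and> L = span {\<gamma>' 0})"

text \<open>
  At a hyperbolic saddle the line \<open>L\<close> below does not depend on the choice of \<open>U\<close> and \<open>N\<close>: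
  each set \<open>Wu_part A U N\<close> with \<open>U\<close> open contains, with any of its points, a small arc
  through that point of the immersed curve \<open>Wu A\<close>.
\<close>

definition Wu_tangent :: "cyl \<Rightarrow> cyl \<Rightarrow> (real \<times> real) set \<Rightarrow> bool" where
  "Wu_tangent A z L \<longleftrightarrow>
     (\<exists>U N. open U \<and> A \<in> U \<and> embedded_curve_tangent (Wu_part A U N) z L)"

definition Ws_tangent :: "cyl \<Rightarrow> cyl \<Rightarrow> (real \<times> real) set \<Rightarrow> bool" where
  "Ws_tangent A z L \<longleftrightarrow>
     (\<exists>U N. open U \<and> A \<in> U \<and> embedded_curve_tangent (Ws_part A U N) z L)"

definition transverse_heteroclinic :: "cyl \<Rightarrow> cyl \<Rightarrow> (int \<Rightarrow> cyl) \<Rightarrow> bool" where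
  "transverse_heteroclinic A B z \<longleftrightarrow>
     is_orbit z \<and> (z \<longlongrightarrow> A) at_bot \<and> (z \<longlongrightarrow> B) at_top \<and>
     (\<forall>n. z n \<in> Wu A \<inter> Ws B \<and>
          (\<exists>L M. Wu_tangent A (z n) L \<and> Ws_tangent B (z n) M \<and> L \<noteq> M))"


section \<open>The fixed-point problem\<close>

text \<open>The inverse of \<open>drift : (-1, 1) \<rightarrow> (-2\<pi>/3, 2\<pi>/3)\<close>; meaningful on that range only.\<close>

definition drift_inv :: "real \<Rightarrow> real" where
  "drift_inv d = sin (d / 2) / sqrt (5 / 4 - cos (d / 2))"

definition s_seq :: "int \<Rightarrow> real" where
  "s_seq n = (if n \<le> 0 then 0 else pi / 2)"

definition sigma :: "int \<Rightarrow> real" where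
  "sigma n = cos (2 * s_seq n)"

definition ball_B :: "(int \<Rightarrow> real) set" where
  "ball_B = {u. bounded (range u) \<and> (SUP n. \<bar>u n\<bar>) \<le> 1 / 8}"

definition theta :: "(int \<Rightarrow> real) \<Rightarrow> int \<Rightarrow> real" where
  "theta u n = s_seq n + u n"

definition T_op :: "(int \<Rightarrow> real) \<Rightarrow> int \<Rightarrow> real" where
  "T_op u n = sigma n / 2 *
     arcsin ((drift_inv (theta u n - theta u (n - 1))
              - drift_inv (theta u (n + 1) - theta u n)) / 16)"

end

theory Submission
  imports Defs
begin

text \<open>
  Write \<open>P\<close> for \<^const>\<open>drift_inv\<close>. Because \<open>P\<close> inverts the drift, a sequence of points \<open>(\<theta>\<^sub>n, p\<^sub>n)\<close> with
  \<open>p\<^sub>n = P (\<theta>\<^sub>n - \<theta>\<^sub>n\<^sub>-\<^sub>1)\<close> is an orbit exactly when \<open>P (\<theta>\<^sub>n - \<theta>\<^sub>n\<^sub>-\<^sub>1) - P (\<theta>\<^sub>n\<^sub>+\<^sub>1 - \<theta>\<^sub>n) = 16 sin (2 \<theta>\<^sub>n)\<close>, and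
  the fixed-point equation is this recurrence, solved for \<open>u\<^sub>n\<close>. So the sequence is an orbit.

  Close to a saddle the factor 16 dominates the recurrence, since \<open>P\<close> is 1-Lipschitz. Two solutions that
  stay within \<open>1/8\<close> of the saddle for all backward times approach each other by a factor 4 in each backward
  step (\<open>local_seq_contract\<close>), and for each starting angle there is exactly one (\<open>local_seq_exists\<close>,
  \<open>local_seq_unique\<close>). Comparison with the zero solution shows that the given orbit tends to \<open>X\<close>. It also
  follows that the local unstable set of a saddle is a graph over the angle (\<open>Wu_part_strip\<close>), described by
  the map \<open>backstep\<close> that takes an angle to the preceding one.

  This map is continuously differentiable because the slopes of its chords satisfy a contracting
  recursion whose coefficients are divided differences of \<open>P\<close> and of the sine. The recursion makes sense on the
  diagonal too, and its uniform limit is a continuous extension of the chord slope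
  (\<open>backstep_continuously_differentiable\<close>).

  The map carries the local curve of \<open>X\<close> along the orbit (\<open>unstable_curve_along_orbit\<close>). All points of the
  orbit have \<open>\<bar>cos (2 \<theta>)\<bar> \<ge> 24/25\<close>, so the cone \<open>\<bar>dp\<bar> \<le> 2 \<bar>d\<theta>\<bar>\<close> is invariant and contains the tangents of the
  unstable curve at every point of the orbit.

  The recurrence is symmetric under reversal of time. The corresponding involution \<open>reversor\<close> of the
  cylinder turns the stable set of \<open>Y\<close> into the unstable set of \<open>Y\<close>, and the given orbit into one that leaves
  \<open>Y\<close>, so the results on unstable curves apply to it (\<open>Ws_part_reversor\<close>). The reversor maps the unstable cone
  into the cone \<open>\<bar>dp\<bar> \<ge> 28 \<bar>d\<theta>\<bar>\<close>. The two cones have only 0 in common, so the tangent lines of the two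
  curves differ.
\<close>

section \<open>Topology of the cylinder\<close>

lemma circ_of_eq_iff: "circ_of x = circ_of y \<longleftrightarrow> (\<exists>k::int. x = y + of_int k * pi)"
  unfolding eq_mod_pi_def[symmetric] 
  by (transfer, auto simp: eq_mod_pi_def algebra_simps)

lemma circ_cases: obtains x where "c = circ_of x"
proof -
  have "\<exists>x. c = circ_of x" by transfer (auto simp: eq_mod_pi_def intro!: exI[of _ "0::int"])
  then show ?thesis using that by blast
qed

lemma cyl_cases: obtains q where "z = cyl_of q"
proof -
  obtain x where "fst z = circ_of x" by (rule circ_cases)
  then show ?thesis using that[of "(x, snd z)"] by (simp add: cyl_of_def prod_eq_iff)
qed

text \<open>
  The saturation of a set under the covering map is the union of its translates by multiples of
  \<open>\<pi>\<close>, so the covering map is open, and with it \<^const>\<open>cyl_of\<close>.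
\<close>

lemma open_circ_of_image:
  assumes "open A" shows "open (circ_of ` A)"
proof -
  have "circ_of -` circ_of ` A = (\<Union>k::int. (\<lambda>y. of_int k * pi + y) ` A)"
  proof (intro set_eqI iffI)
    fix x assume "x \<in> circ_of -` circ_of ` A"
    then obtain y where "y \<in> A" "circ_of x = circ_of y" by auto
    then obtain k :: int where "y \<in> A" "x = of_int k * pi + y" unfolding circ_of_eq_iff by auto
    then show "x \<in> (\<Union>k::int. (\<lambda>y. of_int k * pi + y) ` A)" by blast
  next
    fix x assume "x \<in> (\<Union>k::int. (\<lambda>y. of_int k * pi + y) ` A)"
    then obtain k :: int and y where "y \<in> A" "x = y + of_int k * pi" by auto
    then show "x \<in> circ_of -` circ_of ` A"
      using circ_of_eq_iff by blast
  qed
  then show ?thesis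
    using assms by (auto simp: open_circ_def intro!: open_translation)
qed

lemma open_cyl_of_image:
  assumes "open A" shows "open (cyl_of ` A)"
proof (subst open_prod_def, intro ballI)
  fix z assume "z \<in> cyl_of ` A"
  then obtain q where q: "q \<in> A" "z = cyl_of q" by blast
  then obtain B C where BC: "open B" "open C" "q \<in> B \<times> C" "B \<times> C \<subseteq> A"
    using assms by (metis open_prod_def)
  have "circ_of ` B \<times> C \<subseteq> cyl_of ` A"
  proof
    fix y assume "y \<in> circ_of ` B \<times> C"
    then obtain b where "b \<in> B" "snd y \<in> C" "y = cyl_of (b, snd y)" by (auto simp: cyl_of_def)
    then show "y \<in> cyl_of ` A" using BC(4) by blast
  qed
  moreover have "z \<in> circ_of ` B \<times> C" using q BC(3) by (auto simp: cyl_of_def)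
  ultimately show "\<exists>B C. open B \<and> open C \<and> z \<in> B \<times> C \<and> B \<times> C \<subseteq> cyl_of ` A"
    using BC(2) open_circ_of_image[OF BC(1)] by (intro exI[of _ "circ_of ` B"] exI[of _ C] conjI)
qed

lemma continuous_on_circ_of: "continuous_on A circ_of"
  by (rule continuous_on_subset[of UNIV]) (auto simp: continuous_on_open_vimage open_circ_def)

lemma continuous_on_cyl_of: "continuous_on A cyl_of"
  unfolding cyl_of_def
  by (intro continuous_intros continuous_on_compose2[OF continuous_on_circ_of[of UNIV]]) auto

lemma open_cyl_of_vimage: "open D \<Longrightarrow> open (cyl_of -` D)"
  using continuous_on_cyl_of[of UNIV] by (simp add: continuous_on_open_vimage)

text \<open>
  An open continuous surjection is a quotient map, also over each open set \<open>D\<close>. So continuity on the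
  cylinder can be checked on lifts to the plane, where the usual continuity rules apply.
\<close>

lemma continuous_on_cyl_lift:
  fixes \<Phi> :: "cyl \<Rightarrow> 'a::topological_space"
  assumes "open D" and cont: "continuous_on (cyl_of -` D) (\<lambda>q. \<Phi> (cyl_of q))"
  shows "continuous_on D \<Phi>"
  unfolding continuous_on_open_vimage[OF assms(1)]
proof (intro allI impI)
  fix B :: "'a set" assume "open B"
  then have "open ((\<lambda>q. \<Phi> (cyl_of q)) -` B \<inter> cyl_of -` D)"
    using cont continuous_on_open_vimage[OF open_cyl_of_vimage[OF assms(1)]] by blast
  then have "open (cyl_of ` ((\<lambda>q. \<Phi> (cyl_of q)) -` B \<inter> cyl_of -` D))"
    by (rule open_cyl_of_image)
  moreover have "cyl_of ` ((\<lambda>q. \<Phi> (cyl_of q)) -` B \<inter> cyl_of -` D) = \<Phi> -` B \<inter> D"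
  proof (intro set_eqI iffI)
    fix z assume "z \<in> \<Phi> -` B \<inter> D"
    moreover obtain q where "z = cyl_of q" by (rule cyl_cases)
    ultimately show "z \<in> cyl_of ` ((\<lambda>q. \<Phi> (cyl_of q)) -` B \<inter> cyl_of -` D)" by blast
  qed auto
  ultimately show "open (\<Phi> -` B \<inter> D)" by simp
qed

section \<open>The drift and its inverse\<close>

definition drift' :: "real \<Rightarrow> real" where
  "drift' p = 2 / sqrt (1 - p\<^sup>2) - 1 / sqrt (1 - (p / 2)\<^sup>2)"

lemma drift_has_derivative:
  assumes "\<bar>p\<bar> < 1" shows "(drift has_real_derivative drift' p) (at p)"
proof -
  have "(arcsin has_real_derivative inverse (sqrt (1 - q\<^sup>2))) (at q)" if "\<bar>q\<bar> < 1" for q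
    using that by (intro DERIV_arcsin) auto
  then have "((\<lambda>q. arcsin (q / 2)) has_real_derivative inverse (sqrt (1 - (p / 2)\<^sup>2)) * (1 / 2)) (at p)"
    "(arcsin has_real_derivative inverse (sqrt (1 - p\<^sup>2))) (at p)"
    using assms by (auto intro!: DERIV_chain2[where g = "\<lambda>q. q / 2"] derivative_eq_intros)
  from DERIV_cmult[OF DERIV_diff[OF this(2,1)], of 2]
  have "(drift has_real_derivative
      2 * (inverse (sqrt (1 - p\<^sup>2)) - inverse (sqrt (1 - (p / 2)\<^sup>2)) * (1 / 2))) (at p)"
    unfolding drift_def[abs_def] .
  also have "2 * (inverse (sqrt (1 - p\<^sup>2)) - inverse (sqrt (1 - (p / 2)\<^sup>2)) * (1 / 2)) = drift' p"
    unfolding drift'_def inverse_eq_divide right_diff_distrib by simp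
  finally show ?thesis .
qed

text \<open>
  The lower bound of the twist. It makes the inverse of the drift 1-Lipschitz and keeps the unstable
  cone narrow.
\<close>

lemma drift'_ge_1:
  assumes "\<bar>p\<bar> < 1" shows "1 \<le> drift' p"
proof -
  have p: "p\<^sup>2 < 1" using assms by (simp add: abs_square_less_1)
  have "1 / sqrt (1 - (p / 2)\<^sup>2) \<le> 1 / sqrt (1 - p\<^sup>2)"
    by (rule divide_left_mono) (use p in \<open>auto simp: power_divide\<close>)
  moreover have "1 \<le> 1 / sqrt (1 - p\<^sup>2)" using p by simp
  ultimately show ?thesis unfolding drift'_def by simp
qed

lemma continuous_on_drift': "continuous_on {-1<..<1} drift'"
proof -
  have "p\<^sup>2 < 1" if "-1 < p" "p < 1" for p :: real
    using that by (simp add: abs_square_less_1)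
  then show ?thesis
    unfolding drift'_def[abs_def] by (intro continuous_intros) (force simp: power_divide)+
qed

lemma drift_minus: "\<bar>p\<bar> \<le> 1 \<Longrightarrow> drift (- p) = - drift p"
  by (simp add: drift_def arcsin_minus)

lemma drift_strict_mono:
  assumes "-1 \<le> p" "p < q" "q \<le> 1" shows "drift p < drift q"
proof (rule DERIV_pos_imp_increasing_open[OF assms(2)])
  show "\<exists>y. (drift has_real_derivative y) (at x) \<and> y > 0" if "p < x" "x < q" for x
    using that assms drift_has_derivative[of x] drift'_ge_1[of x] by (intro exI[of _ "drift' x"]) fastforce
  show "continuous_on {p..q} drift"
    unfolding drift_def[abs_def] using assms by (intro continuous_intros) auto
qed

lemma abs_drift_less:
  assumes "\<bar>p\<bar> < 1" shows "\<bar>drift p\<bar> < 2 * pi / 3"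
proof -
  have "drift p < drift 1" "drift (-1) < drift p" using assms by (intro drift_strict_mono; simp)+
  moreover have "drift 1 = 2 * pi / 3"
    using arcsin_sin[of "pi/6"] by (simp add: drift_def sin_30)
  ultimately show ?thesis using drift_minus[of 1] by simp
qed

text \<open>
  With \<open>a = d/2\<close> and \<open>r\<^sup>2 = 5/4 - cos a\<close>, let \<open>b\<close> be the angle with \<open>sin b = sin a / (2 r)\<close>. In the triangle
  with sides \<open>1\<close> and \<open>1/2\<close> enclosing the angle \<open>a\<close>, the third side is \<open>r\<close>, and the law of sines gives
  \<open>sin (a + b) = sin a / r\<close>. Hence \<open>arcsin p = a + b\<close> and \<open>arcsin (p/2) = b\<close> for \<open>p = sin a / r\<close>, and the
  drift of \<open>p\<close> is \<open>2 a = d\<close>. The condition \<open>cos a > 1/2\<close>, that is \<open>\<bar>d\<bar> < 2 \<pi>/3\<close>, selects the branch of the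
  arcsine and gives \<open>\<bar>p\<bar> < 1\<close>.
\<close>

lemma drift_inv_props:
  assumes "\<bar>d\<bar> < 2 * pi / 3"
  shows drift_inv_bound: "\<bar>drift_inv d\<bar> < 1" and drift_drift_inv: "drift (drift_inv d) = d"
proof -
  define a where "a = d / 2"
  define r where "r = sqrt (5/4 - cos a)"
  have a: "\<bar>a\<bar> < pi / 3" using assms by (simp add: a_def)
  have "cos (pi/3) < cos \<bar>a\<bar>" using a by (intro cos_monotone_0_pi) auto
  then have ca: "cos a > 1/2" by (simp add: cos_60)
  have r2: "r\<^sup>2 = 5/4 - cos a" and r0: "r > 0"
  proof -
    have "0 < 5/4 - cos a" using cos_le_one[of a] by linarith
    then show "r\<^sup>2 = 5/4 - cos a" "r > 0" by (simp_all add: r_def)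
  qed
  define p where "p = sin a / r"
  have P: "drift_inv d = p" by (simp add: drift_inv_def p_def a_def r_def)
  have s2: "(sin a)\<^sup>2 = 1 - (cos a)\<^sup>2" by (simp add: sin_squared_eq)
  \<comment> \<open>this difference is positive as \<open>cos a > 1/2\<close>, which bounds \<open>p\<close>\<close>
  have "r\<^sup>2 - (sin a)\<^sup>2 = (cos a - 1/2)\<^sup>2" unfolding r2 s2 by (simp add: power2_eq_square algebra_simps)
  moreover have "0 < (cos a - 1/2)\<^sup>2" using ca by simp
  ultimately have "(sin a)\<^sup>2 < r\<^sup>2" by linarith
  then have "p\<^sup>2 < 1" using r0 by (simp add: p_def power_divide)
  then have p1: "\<bar>p\<bar> < 1" by (simp add: abs_square_less_1)
  show "\<bar>drift_inv d\<bar> < 1" using p1 P by simp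
  define b where "b = arcsin (p / 2)"
  have sb: "sin b = p / 2" unfolding b_def using p1 by (intro sin_arcsin) auto
  have "b < arcsin (1/2)" "arcsin (-1/2) < b"
    unfolding b_def using p1 by (intro arcsin_less_arcsin; auto)+
  moreover have "arcsin (1/2) = pi / 6" using arcsin_sin[of "pi/6"] by (simp add: sin_30)
  ultimately have b: "\<bar>b\<bar> < pi / 6" using arcsin_minus[of "1/2"] by auto
  have "(cos b)\<^sup>2 = 1 - (p/2)\<^sup>2" unfolding sb[symmetric] by (simp add: cos_squared_eq)
  also have "\<dots> = ((1 - cos a / 2) / r)\<^sup>2"
  proof -
    have "r\<^sup>2 - (sin a)\<^sup>2 / 4 = (1 - cos a / 2)\<^sup>2"
      unfolding r2 s2 by (simp add: power2_eq_square field_simps)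
    then show ?thesis using r0 by (simp add: p_def power_divide divide_simps)
  qed
  finally have sq: "(cos b)\<^sup>2 = ((1 - cos a / 2) / r)\<^sup>2" .
  have "0 \<le> cos b" using b by (intro cos_ge_zero) auto
  moreover have "0 \<le> (1 - cos a / 2) / r" using r0 cos_le_one[of a] by (intro divide_nonneg_pos) linarith+
  ultimately have "cos b = (1 - cos a / 2) / r" using sq power2_eq_iff_nonneg by blast
  then have "sin (a + b) = sin a * ((1 - cos a / 2) / r) + cos a * (sin a / r / 2)"
    by (simp add: sin_add sb p_def)
  also have "\<dots> = p" using r0 by (simp add: p_def divide_simps) (simp add: algebra_simps)
  finally have "sin (a + b) = p" .
  then have "arcsin p = a + b" using a b by (intro arcsin_unique) auto
  then show "drift (drift_inv d) = d" by (simp add: P drift_def b_def[symmetric] a_def)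
qed

lemma drift_inv_drift:
  assumes "\<bar>p\<bar> < 1" shows "drift_inv (drift p) = p"
proof -
  let ?q = "drift_inv (drift p)"
  have "drift ?q = drift p" "\<bar>?q\<bar> < 1"
    using drift_inv_props[OF abs_drift_less[OF assms]] by auto
  then show ?thesis
    using drift_strict_mono[of p ?q] drift_strict_mono[of ?q p] assms by force
qed

lemma drift_inv_minus: "drift_inv (- d) = - drift_inv d"
  by (simp add: drift_inv_def)

lemma drift_inv_0 [simp]: "drift_inv 0 = 0"
  by (simp add: drift_inv_def)

definition drift_inv' :: "real \<Rightarrow> real" where
  "drift_inv' d = inverse (drift' (drift_inv d))"

lemma continuous_on_drift_inv: "continuous_on A drift_inv"
proof -
  have "5/4 - cos x > 0" for x :: real using cos_le_one[of x] by linarith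
  then show ?thesis
    unfolding drift_inv_def[abs_def]
    by (intro continuous_intros) (auto, metis less_irrefl)
qed

lemma drift_inv_has_derivative:
  assumes "\<bar>d\<bar> < 2 * pi / 3" shows "(drift_inv has_real_derivative drift_inv' d) (at d)"
  unfolding drift_inv'_def
proof (rule DERIV_inverse_function[where a = "-2*pi/3" and b = "2*pi/3" and f = drift])
  show "(drift has_real_derivative drift' (drift_inv d)) (at (drift_inv d))"
    using assms by (intro drift_has_derivative drift_inv_bound)
  show "drift' (drift_inv d) \<noteq> 0"
    using drift'_ge_1[OF drift_inv_bound[OF assms]] by linarith
  show "isCont drift_inv d"
    using continuous_on_drift_inv[of UNIV] by (simp add: continuous_on_eq_continuous_at)
qed (use assms in \<open>auto intro!: drift_drift_inv\<close>)

lemma drift_inv'_bounds: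
  assumes "\<bar>d\<bar> < 2 * pi / 3" shows "0 < drift_inv' d" "drift_inv' d \<le> 1"
  using drift'_ge_1[OF drift_inv_bound[OF assms]]
  by (auto simp: drift_inv'_def inverse_le_1_iff)

lemma continuous_on_drift_inv': "continuous_on {-1..1} drift_inv'"
proof -
  have *: "\<bar>drift_inv d\<bar> < 1" if "d \<in> {-1..1}" for d
    using that pi_gt3 by (intro drift_inv_bound) auto
  have "continuous_on {-1..1} (\<lambda>d. drift' (drift_inv d))"
    by (rule continuous_on_compose2[OF continuous_on_drift' continuous_on_drift_inv])
       (use * in \<open>force simp: abs_less_iff\<close>)
  moreover have "drift' (drift_inv d) \<noteq> 0" if "d \<in> {-1..1}" for d
    using drift'_ge_1[OF *[OF that]] by linarith
  ultimately show ?thesis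
    unfolding drift_inv'_def[abs_def] by (intro continuous_on_inverse) auto
qed

section \<open>The map, its inverse and its time reversal\<close>

lemma circ_sin2_circ_of [simp]: "circ_sin2 (circ_of x) = sin (2 * x)"
  by transfer simp

lemma circ_shift_circ_of [simp]: "circ_shift (circ_of x) d = circ_of (x + d)"
  by transfer (simp add: eq_mod_pi_def)

lemma fst_cyl_of [simp]: "fst (cyl_of q) = circ_of (fst q)"
  and snd_cyl_of [simp]: "snd (cyl_of q) = snd q"
  by (simp_all add: cyl_of_def)

lemma kick_cyl_of [simp]: "kick (cyl_of q) = snd q - 16 * sin (2 * fst q)"
  by (simp add: kick_def)

definition F0_lift :: "real \<times> real \<Rightarrow> real \<times> real" where
  "F0_lift q = (let p = snd q - 16 * sin (2 * fst q) in (fst q + drift p, p))"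

lemma F0_cyl_of: "F0 (cyl_of q) = cyl_of (F0_lift q)"
  by (simp add: F0_def F0_lift_def Let_def) (simp add: cyl_of_def)

definition F0_inv_lift :: "real \<times> real \<Rightarrow> real \<times> real" where
  "F0_inv_lift q = (let x = fst q - drift (snd q) in (x, snd q + 16 * sin (2 * x)))"

text \<open>
  Inverting the shift needs no restriction on \<open>p\<close>, so \<^const>\<open>F0\<close> is a bijection of the whole cylinder
  with this inverse. In particular every point has at most one backward orbit.
\<close>

definition F0_inv :: "cyl \<Rightarrow> cyl" where
  "F0_inv z = (let c = circ_shift (fst z) (- drift (snd z)) in (c, snd z + 16 * circ_sin2 c))"

lemma F0_inv_cyl_of: "F0_inv (cyl_of q) = cyl_of (F0_inv_lift q)"
  by (simp add: F0_inv_def F0_inv_lift_def Let_def) (simp add: cyl_of_def)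

lemma F0_inv_F0 [simp]: "F0_inv (F0 z) = z"
proof -
  obtain q where "z = cyl_of q" by (rule cyl_cases)
  then show ?thesis
    by (simp add: F0_cyl_of F0_inv_cyl_of F0_inv_lift_def F0_lift_def Let_def)
qed

lemma F0_F0_inv [simp]: "F0 (F0_inv z) = z"
proof -
  obtain q where "z = cyl_of q" by (rule cyl_cases)
  then show ?thesis
    by (simp add: F0_cyl_of F0_inv_cyl_of F0_inv_lift_def F0_lift_def Let_def)
qed

lemma continuous_on_drift: "continuous_on {-1..1} drift"
  unfolding drift_def[abs_def] by (intro continuous_intros) auto

lemma continuous_on_circ_sin2: "continuous_on A circ_sin2"
proof -
  have "continuous_on UNIV circ_sin2"
  proof (subst continuous_on_open_vimage[OF open_UNIV], intro allI impI)
    fix B :: "real set" assume "open B"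
    then have "open ((\<lambda>x. sin (2 * x)) -` B)" 
      by (intro open_vimage continuous_intros)
    moreover have "circ_of -` (circ_sin2 -` B) = (\<lambda>x. sin (2 * x)) -` B" by auto
    ultimately show "open (circ_sin2 -` B \<inter> UNIV)" by (simp add: open_circ_def)
  qed
  then show ?thesis by (rule continuous_on_subset) simp
qed

lemma open_domF: "open domF"
proof -
  have "continuous_on UNIV kick"
    unfolding kick_def[abs_def]
    by (intro continuous_intros continuous_on_compose2[OF continuous_on_circ_sin2[of UNIV]]) auto
  then show ?thesis
    unfolding domF_def by (intro open_Collect_conj open_Collect_less continuous_intros)
qed

text \<open>
  The recurrence \<open>P (\<theta>\<^sub>n - \<theta>\<^sub>n\<^sub>-\<^sub>1) - P (\<theta>\<^sub>n\<^sub>+\<^sub>1 - \<theta>\<^sub>n) = 16 sin (2 \<theta>\<^sub>n)\<close> for the angles of an orbit, with \<open>P\<close> the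
  odd function \<^const>\<open>drift_inv\<close>, is invariant under \<open>n \<mapsto> -n\<close>. In the coordinates of the cylinder this
  time reversal is the involution \<open>(\<theta>\<^sub>n, p\<^sub>n) \<mapsto> (\<theta>\<^sub>n, - p\<^sub>n\<^sub>+\<^sub>1)\<close>.
\<close>

definition reversor :: "cyl \<Rightarrow> cyl" where
  "reversor z = (fst z, - kick z)"

definition reversor_lift :: "real \<times> real \<Rightarrow> real \<times> real" where
  "reversor_lift q = (fst q, 16 * sin (2 * fst q) - snd q)"

lemma reversor_cyl_of: "reversor (cyl_of q) = cyl_of (reversor_lift q)"
  by (simp add: reversor_def reversor_lift_def) (simp add: cyl_of_def)

lemma reversor_reversor [simp]: "reversor (reversor z) = z"
  by (simp add: reversor_def kick_def prod_eq_iff)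

lemma kick_reversor [simp]: "kick (reversor z) = - snd z"
  by (simp add: reversor_def kick_def)

lemma reversor_in_domF_iff [simp]: "reversor z \<in> domF \<longleftrightarrow> z \<in> domF"
  by (auto simp: domF_def reversor_def kick_def)

lemma F0_reversor_F0:
  assumes "z \<in> domF" shows "F0 (reversor (F0 z)) = reversor z"
proof -
  obtain q where q: "z = cyl_of q" by (rule cyl_cases)
  define p where "p = snd q - 16 * sin (2 * fst q)"
  have "\<bar>p\<bar> < 1" using assms by (simp add: domF_def q p_def)
  then have "drift (- p) = - drift p" by (intro drift_minus) simp
  then show ?thesis
    by (simp add: q F0_cyl_of reversor_cyl_of F0_lift_def reversor_lift_def p_def[symmetric])
       (simp add: p_def)
qed

lemma continuous_on_reversor: "continuous_on A reversor"
proof -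
  have "continuous_on UNIV (\<lambda>q. reversor (cyl_of q))"
    unfolding reversor_cyl_of reversor_lift_def
    by (intro continuous_on_compose2[OF continuous_on_cyl_of[of UNIV]] continuous_intros) auto
  then have "continuous_on UNIV reversor" by (intro continuous_on_cyl_lift) simp_all
  then show ?thesis by (rule continuous_on_subset) simp
qed

lemma open_reversor_image: "open U \<Longrightarrow> open (reversor ` U)"
proof -
  assume "open U"
  then have "open (reversor -` U)" by (intro open_vimage continuous_on_reversor)
  moreover have "reversor -` U = reversor ` U"
    by (auto intro: image_eqI[of _ _ "reversor z" for z])
  ultimately show ?thesis by simp
qed

text \<open>
  Time reversal turns backward orbits into forward orbits, so everything about stable sets follows
  from unstable sets. The intersection with \<^const>\<open>domF\<close> appears because a forward orbit starts with a
  point at which the map is applied, whereas a backward orbit may end outside the domain.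
\<close>

lemma Ws_part_reversor: "Ws_part (reversor A) (reversor ` U) N = reversor ` (Wu_part A U N \<inter> domF)"
  (is "?L = ?R")
proof
  have im: "reversor z \<in> reversor ` U \<longleftrightarrow> z \<in> U" for z
    by (metis image_iff reversor_reversor)
  have cont: "(\<lambda>n. reversor (w n)) \<longlonglongrightarrow> reversor B" if "w \<longlonglongrightarrow> B" for w :: "nat \<Rightarrow> cyl" and B
    by (rule continuous_on_tendsto_compose[OF continuous_on_reversor[of UNIV] that]) auto
  show "?L \<subseteq> ?R"
  proof
    fix z assume "z \<in> ?L"
    then obtain w where w: "w 0 = z" "\<And>n. w n \<in> domF" "\<And>n. F0 (w n) = w (Suc n)"
      "w \<longlonglongrightarrow> reversor A" "\<And>n. n \<ge> N \<Longrightarrow> w n \<in> reversor ` U"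
      by (auto simp: Ws_part_def forward_orbit_def)
    have "F0 (reversor (w (Suc n))) = reversor (w n)" for n
      using F0_reversor_F0[OF w(2)] w(3) by metis
    moreover have "w n = reversor (reversor (w n))" for n by simp
    ultimately have "reversor z \<in> Wu_part A U N" "reversor z \<in> domF"
      using w cont[OF w(4)] im
      unfolding Wu_part_def backward_orbit_def
      by (auto intro!: exI[of _ "\<lambda>n. reversor (w n)"]) (metis im reversor_reversor)
    then show "z \<in> ?R" by (metis IntI image_eqI reversor_reversor)
  qed
  show "?R \<subseteq> ?L"
  proof
    fix y assume "y \<in> ?R"
    then obtain z where z: "y = reversor z" "z \<in> Wu_part A U N" "z \<in> domF" by blast
    then obtain w where w: "w 0 = z" "\<And>n. w (Suc n) \<in> domF" "\<And>n. F0 (w (Suc n)) = w n"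
      "w \<longlonglongrightarrow> A" "\<And>n. n \<ge> N \<Longrightarrow> w n \<in> U"
      by (auto simp: Wu_part_def backward_orbit_def)
    have "F0 (reversor (w n)) = reversor (w (Suc n))" for n
      using F0_reversor_F0[OF w(2)] w(3) by metis
    moreover have "w n \<in> domF" for n
      using w(1,2) z(3) by (cases n) auto
    ultimately show "y \<in> ?L"
      using w cont[OF w(4)] im z(1)
      unfolding Ws_part_def forward_orbit_def
      by (auto intro!: exI[of _ "\<lambda>n. reversor (w n)"])
  qed
qed

lemma Wu_part_Suc: "Wu_part A U (Suc N) = F0 ` (Wu_part A U N \<inter> domF)"
proof (intro set_eqI iffI)
  fix z assume "z \<in> Wu_part A U (Suc N)"
  then obtain w where w: "w 0 = z" "\<And>n. w (Suc n) \<in> domF" "\<And>n. F0 (w (Suc n)) = w n"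
      "w \<longlonglongrightarrow> A" "\<And>n. n \<ge> Suc N \<Longrightarrow> w n \<in> U"
    by (auto simp: Wu_part_def backward_orbit_def)
  then have "w 1 \<in> Wu_part A U N"
    unfolding Wu_part_def backward_orbit_def
    by (auto intro!: exI[of _ "\<lambda>n. w (Suc n)"] LIMSEQ_Suc)
  then show "z \<in> F0 ` (Wu_part A U N \<inter> domF)"
    using w(1) w(2)[of 0] w(3)[of 0] by (auto intro!: image_eqI[of _ _ "w 1"])
next
  fix z assume "z \<in> F0 ` (Wu_part A U N \<inter> domF)"
  then obtain y where y: "z = F0 y" "y \<in> Wu_part A U N" "y \<in> domF" by blast
  then obtain w where w: "w 0 = y" "\<And>n. w (Suc n) \<in> domF" "\<And>n. F0 (w (Suc n)) = w n"
      "w \<longlonglongrightarrow> A" "\<And>n. n \<ge> N \<Longrightarrow> w n \<in> U"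
    by (auto simp: Wu_part_def backward_orbit_def)
  define w' where "w' n = (case n of 0 \<Rightarrow> z | Suc n \<Rightarrow> w n)" for n
  have "backward_orbit z w'"
    using w y by (auto simp: backward_orbit_def w'_def split: nat.split)
  moreover have "w' \<longlonglongrightarrow> A"
    by (rule LIMSEQ_imp_Suc) (use w(4) in \<open>simp add: w'_def\<close>)
  moreover have "w' n \<in> U" if "n \<ge> Suc N" for n
    using that w(5) by (cases n) (auto simp: w'_def)
  ultimately show "z \<in> Wu_part A U (Suc N)" unfolding Wu_part_def by blast
qed

section \<open>Images of embedded curves\<close>

text \<open>
  Diffeomorphisms between open subsets of the cylinder map embedded curves to embedded curves and
  tangent lines by their derivative. Differentiability is expressed through a lift \<open>\<phi>\<close> to the plane.
  The parametrizing interval has to be shrunk so that the arc stays in the domain \<open>D\<close>, and then the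
  neighbourhood of the base point has to be shrunk with it, so that it meets the curve in the smaller
  arc only; the second step uses that the parametrization is a homeomorphism onto its image.
\<close>

lemma embedded_curve_tangent_image:
  fixes \<phi> :: "real \<times> real \<Rightarrow> real \<times> real" and \<Phi> \<Psi> :: "cyl \<Rightarrow> cyl"
  assumes curve: "embedded_curve_tangent S z L"
    and D: "open D" "z \<in> D"
    and \<Phi>: "continuous_on D \<Phi>" "open (\<Phi> ` D)" 
    and \<Psi>: "continuous_on (\<Phi> ` D) \<Psi>" "\<And>y. y \<in> D \<Longrightarrow> \<Psi> (\<Phi> y) = y"
    and lift: "\<And>q. cyl_of q \<in> D \<Longrightarrow> cyl_of (\<phi> q) = \<Phi> (cyl_of q)"
    and der: "\<And>q. cyl_of q \<in> D \<Longrightarrow> (\<phi> has_derivative J q) (at q)"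
    and inj: "\<And>q v. cyl_of q \<in> D \<Longrightarrow> J q v = 0 \<Longrightarrow> v = 0"
    and cont: "continuous_on ((cyl_of -` D) \<times> UNIV) (\<lambda>(q, v). J q v)"
  shows "\<exists>q. cyl_of q = z \<and> embedded_curve_tangent (\<Phi> ` (S \<inter> D)) (\<Phi> z) (J q ` L)"
proof -
  obtain V \<gamma> \<gamma>' h where V: "open V" "z \<in> V"
    and hom: "homeomorphism {-1<..<1} (S \<inter> V) (\<lambda>t::real. cyl_of (\<gamma> t)) h"
    and \<gamma>: "\<And>t. t \<in> {-1<..<1} \<Longrightarrow> (\<gamma> has_vector_derivative \<gamma>' t) (at t)"
      "\<And>t. t \<in> {-1<..<1} \<Longrightarrow> \<gamma>' t \<noteq> 0"
    and \<gamma>': "continuous_on {-1<..<1} \<gamma>'"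
    and \<gamma>0: "cyl_of (\<gamma> 0) = z" and L: "L = span {\<gamma>' 0}"
    using curve unfolding embedded_curve_tangent_def by blast
  let ?I = "{-1<..<1::real}"
  have hom1: "h (cyl_of (\<gamma> t)) = t" "cyl_of (\<gamma> t) \<in> S \<inter> V" if "t \<in> ?I" for t
    using hom that unfolding homeomorphism_def by auto
  have hom2: "cyl_of (\<gamma> (h y)) = y" "h y \<in> ?I" if "y \<in> S \<inter> V" for y
    using hom that unfolding homeomorphism_def by auto
  have cg: "continuous_on ?I (\<lambda>t. cyl_of (\<gamma> t))" and ch: "continuous_on (S \<inter> V) h"
    using hom unfolding homeomorphism_def by auto
  have "open ((\<lambda>t. cyl_of (\<gamma> t)) -` D \<inter> ?I)"
    by (rule continuous_on_open_vimage[THEN iffD1, rule_format, OF _ cg D(1)]) simp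
  moreover have "0 \<in> (\<lambda>t. cyl_of (\<gamma> t)) -` D \<inter> ?I" using \<gamma>0 D(2) by auto
  ultimately obtain e where "e > 0" "ball 0 e \<subseteq> (\<lambda>t. cyl_of (\<gamma> t)) -` D \<inter> ?I"
    by (rule openE)
  then have e: "e > 0" "\<And>t. \<bar>t\<bar> < e \<Longrightarrow> t \<in> ?I \<and> cyl_of (\<gamma> t) \<in> D"
    by (auto simp: subset_iff)
  \<comment> \<open>the inverse parametrization is continuous, so a short parameter interval is cut out by an open set\<close>
  obtain W where W: "open W" "W \<inter> (S \<inter> V) = h -` {-e<..<e} \<inter> (S \<inter> V)"
    using ch unfolding continuous_on_open_invariant by (meson open_greaterThanLessThan)
  have hW: "\<bar>h y\<bar> < e" if "y \<in> S" "y \<in> V" "y \<in> W" for y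
  proof -
    have "y \<in> h -` {-e<..<e} \<inter> (S \<inter> V)" using W(2) that by blast
    then show ?thesis by auto
  qed
  define V' where "V' = \<Phi> ` (D \<inter> (V \<inter> W))"
  have SV: "y \<in> S \<inter> (D \<inter> (V \<inter> W)) \<longleftrightarrow> (\<exists>t. \<bar>t\<bar> < e \<and> y = cyl_of (\<gamma> t))" (is "?l \<longleftrightarrow> ?r") for y
  proof
    assume ?l
    then have "\<bar>h y\<bar> < e" using hW by auto
    moreover have "y = cyl_of (\<gamma> (h y))" using hom2 \<open>?l\<close> by auto
    ultimately show ?r by blast
  next
    assume ?r
    then obtain t where t: "\<bar>t\<bar> < e" "y = cyl_of (\<gamma> t)" by blast
    have "t \<in> ?I" "y \<in> D" using e(2)[OF t(1)] t by auto
    then have y: "h y = t" "y \<in> S \<inter> V" using hom1 t by auto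
    then have "y \<in> h -` {-e<..<e} \<inter> (S \<inter> V)" using t(1) by auto
    then show ?l using W(2) \<open>y \<in> D\<close> by blast
  qed
  have V'_eq: "V' = \<Psi> -` (D \<inter> (V \<inter> W)) \<inter> \<Phi> ` D"
    unfolding V'_def using \<Psi>(2) by (auto intro!: rev_image_eqI)
  have "open V'"
    unfolding V'_eq using D(1) V(1) W(1)
    by (intro continuous_on_open_vimage[THEN iffD1, rule_format, OF \<Phi>(2) \<Psi>(1)] open_Int)
  have "z \<in> S \<inter> (D \<inter> (V \<inter> W))" using SV[of z] e(1) \<gamma>0 by (metis abs_zero)
  then have zV': "\<Phi> z \<in> V'" unfolding V'_def by blast
  have img: "\<Phi> ` (S \<inter> D) \<inter> V' = \<Phi> ` (S \<inter> (D \<inter> (V \<inter> W)))"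
  proof
    show "\<Phi> ` (S \<inter> D) \<inter> V' \<subseteq> \<Phi> ` (S \<inter> (D \<inter> (V \<inter> W)))"
    proof
      fix x assume "x \<in> \<Phi> ` (S \<inter> D) \<inter> V'"
      then obtain a b where ab: "x = \<Phi> a" "a \<in> S" "a \<in> D" "x = \<Phi> b" "b \<in> D \<inter> (V \<inter> W)"
        unfolding V'_def by blast
      then have "a = b" using \<Psi>(2) by (metis IntD1)
      then show "x \<in> \<Phi> ` (S \<inter> (D \<inter> (V \<inter> W)))" using ab by blast
    qed
  qed (auto simp: V'_def)
  have sc: "\<bar>e * t\<bar> < e" if "t \<in> ?I" for t
    using that e(1) by (auto simp: abs_mult abs_less_iff)
  define \<delta> where "\<delta> t = \<phi> (\<gamma> (e * t))" for t
  define \<delta>' where "\<delta>' t = e *\<^sub>R J (\<gamma> (e * t)) (\<gamma>' (e * t))" for t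
  have lin: "linear (J q)" if "cyl_of q \<in> D" for q
    using der[OF that] by (rule has_derivative_linear)
  have \<delta>_lift: "cyl_of (\<delta> t) = \<Phi> (cyl_of (\<gamma> (e * t)))" if "t \<in> ?I" for t
    unfolding \<delta>_def using e(2)[OF sc[OF that]] by (intro lift) auto
  have \<delta>_der: "(\<delta> has_vector_derivative \<delta>' t) (at t)" if t: "t \<in> ?I" for t
  proof -
    have et: "e * t \<in> ?I" "cyl_of (\<gamma> (e * t)) \<in> D" using e(2)[OF sc[OF t]] by auto
    have "((\<phi> \<circ> \<gamma>) has_vector_derivative J (\<gamma> (e * t)) (\<gamma>' (e * t))) (at (e * t))"
      by (rule vector_derivative_diff_chain_within[OF \<gamma>(1)[OF et(1)]])
         (rule has_derivative_at_withinI[OF der[OF et(2)]])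
    moreover have "((*) e has_vector_derivative e) (at t)"
      by (auto intro!: derivative_eq_intros simp: has_real_derivative_iff_has_vector_derivative[symmetric])
    ultimately show ?thesis
      using vector_diff_chain_at[of "(*) e" e t "\<phi> \<circ> \<gamma>"] unfolding \<delta>_def[abs_def] \<delta>'_def o_def by blast
  qed
  have \<delta>'_nz: "\<delta>' t \<noteq> 0" if t: "t \<in> ?I" for t
    using inj[of "\<gamma> (e * t)" "\<gamma>' (e * t)"] \<gamma>(2)[of "e * t"] e(1) e(2)[OF sc[OF t]]
    unfolding \<delta>'_def by auto
  have \<gamma>_cont: "continuous_on ?I \<gamma>"
    using \<gamma>(1) by (meson continuous_at_imp_continuous_on has_vector_derivative_continuous)
  have "continuous_on ?I (\<lambda>t. J (\<gamma> (e * t)) (\<gamma>' (e * t)))"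
  proof -
    have "continuous_on ?I (\<lambda>t. (\<gamma> (e * t), \<gamma>' (e * t)))"
      using e(2) sc by (intro continuous_intros continuous_on_compose2[OF \<gamma>_cont]
          continuous_on_compose2[OF \<gamma>']) blast+
    moreover have "(\<lambda>t. (\<gamma> (e * t), \<gamma>' (e * t))) ` ?I \<subseteq> cyl_of -` D \<times> UNIV"
      using e(2) sc by blast
    ultimately show ?thesis using continuous_on_compose2[OF cont] by fastforce
  qed
  then have \<delta>'_cont: "continuous_on ?I \<delta>'" unfolding \<delta>'_def[abs_def] by (intro continuous_intros)
  have "homeomorphism ?I (\<Phi> ` (S \<inter> D) \<inter> V') (\<lambda>t. cyl_of (\<delta> t)) (\<lambda>y. h (\<Psi> y) / e)"
  proof (rule homeomorphismI)
    have \<delta>_cont: "continuous_on ?I \<delta>"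
      using \<delta>_der by (meson continuous_at_imp_continuous_on has_vector_derivative_continuous)
    show "continuous_on ?I (\<lambda>t. cyl_of (\<delta> t))"
      by (rule continuous_on_compose2[OF continuous_on_cyl_of[of UNIV] \<delta>_cont]) auto
    show "continuous_on (\<Phi> ` (S \<inter> D) \<inter> V') (\<lambda>y. h (\<Psi> y) / e)"
      unfolding img using e(1) \<Psi>(2)
      by (intro continuous_on_divide continuous_on_const continuous_on_compose2[OF ch]
          continuous_on_subset[OF \<Psi>(1)]) auto
    show "(\<lambda>t. cyl_of (\<delta> t)) ` ?I \<subseteq> \<Phi> ` (S \<inter> D) \<inter> V'"
    proof (intro image_subsetI)
      fix t assume t: "t \<in> ?I"
      then have "cyl_of (\<gamma> (e * t)) \<in> S \<inter> (D \<inter> (V \<inter> W))" using SV sc by blast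
      then show "cyl_of (\<delta> t) \<in> \<Phi> ` (S \<inter> D) \<inter> V'"
        unfolding img \<delta>_lift[OF t] by (rule imageI)
    qed
    show "(\<lambda>y. h (\<Psi> y) / e) ` (\<Phi> ` (S \<inter> D) \<inter> V') \<subseteq> ?I"
    proof (intro image_subsetI)
      fix y assume "y \<in> \<Phi> ` (S \<inter> D) \<inter> V'"
      then obtain x where x: "y = \<Phi> x" "x \<in> S \<inter> (D \<inter> (V \<inter> W))" unfolding img by blast
      then have "\<bar>h x\<bar> < e" "\<Psi> y = x" using hW \<Psi>(2) by auto
      then show "h (\<Psi> y) / e \<in> ?I" using e(1) by (auto simp: field_simps)
    qed
    show "h (\<Psi> (cyl_of (\<delta> t))) / e = t" if "t \<in> ?I" for t
      using \<delta>_lift[OF that] \<Psi>(2) hom1(1) e(1) e(2)[OF sc[OF that]] by auto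
    show "cyl_of (\<delta> (h (\<Psi> y) / e)) = y" if y: "y \<in> \<Phi> ` (S \<inter> D) \<inter> V'" for y
    proof -
      obtain x where x: "y = \<Phi> x" "x \<in> S \<inter> (D \<inter> (V \<inter> W))" using y unfolding img by blast
      then have *: "\<Psi> y = x" "\<bar>h x\<bar> < e" "cyl_of (\<gamma> (h x)) = x"
        using \<Psi>(2) hom2 hW by auto
      then have "h x / e \<in> ?I" using e(1) by (auto simp: field_simps)
      from \<delta>_lift[OF this] show ?thesis using * x e(1) by simp
    qed
  qed
  moreover have "cyl_of (\<delta> 0) = \<Phi> z" using \<delta>_lift[of 0] \<gamma>0 by simp
  moreover have "J (\<gamma> 0) ` L = span {\<delta>' 0}"
  proof -
    have l: "linear (J (\<gamma> 0))" using lin \<gamma>0 D(2) by simp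
    have "span {e *\<^sub>R J (\<gamma> 0) (\<gamma>' 0)} = span {J (\<gamma> 0) (\<gamma>' 0)}"
      using e(1) span_image_scale[of "{J (\<gamma> 0) (\<gamma>' 0)}" "\<lambda>_. e"] by simp
    then show ?thesis
      unfolding L \<delta>'_def using linear_span_image[OF l, of "{\<gamma>' 0}"] by simp
  qed
  ultimately have "embedded_curve_tangent (\<Phi> ` (S \<inter> D)) (\<Phi> z) (J (\<gamma> 0) ` L)"
    unfolding embedded_curve_tangent_def
    using \<open>open V'\<close> zV' \<delta>_der \<delta>'_nz \<delta>'_cont
    by (intro exI[of _ V'] exI[of _ \<delta>] exI[of _ \<delta>'] exI[of _ "\<lambda>y. h (\<Psi> y) / e"]) auto
  then show ?thesis using \<gamma>0 by blast
qed

section \<open>Invariant cones\<close>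

text \<open>
  These two families of lines meet only in \<open>0\<close>; transversality is proved by placing the tangent
  of the unstable curve in the first and the tangent of the stable curve in the second.
\<close>

definition unstable_cone :: "(real \<times> real) set" where
  "unstable_cone = {v. \<bar>snd v\<bar> \<le> 2 * \<bar>fst v\<bar>}"

definition stable_cone :: "(real \<times> real) set" where
  "stable_cone = {v. 28 * \<bar>fst v\<bar> \<le> \<bar>snd v\<bar>}"

definition F0_deriv :: "real \<times> real \<Rightarrow> real \<times> real \<Rightarrow> real \<times> real" where
  "F0_deriv q v = (let b = snd v - 32 * cos (2 * fst q) * fst v
                   in (fst v + drift' (snd q - 16 * sin (2 * fst q)) * b, b))"

lemma domF_cyl_of: "cyl_of q \<in> domF \<longleftrightarrow> \<bar>snd q\<bar> < 1 \<and> \<bar>snd q - 16 * sin (2 * fst q)\<bar> < 1"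
  by (simp add: domF_def)

lemma kick_has_derivative:
  "((\<lambda>q. snd q - 16 * sin (2 * fst q)) has_derivative
     (\<lambda>v. snd v - 32 * cos (2 * fst q) * fst v)) (at (q :: real \<times> real))"
  by (auto intro!: derivative_eq_intros)

lemma F0_lift_has_derivative:
  assumes "cyl_of q \<in> domF" shows "(F0_lift has_derivative F0_deriv q) (at q)"
proof -
  let ?k = "\<lambda>q. snd q - 16 * sin (2 * fst q)"
  have "(drift has_derivative (\<lambda>b. drift' (?k q) * b)) (at (?k q))"
    using drift_has_derivative assms by (simp add: domF_cyl_of has_field_derivative_def mult_commute_abs)
  from has_derivative_compose[OF kick_has_derivative this]
  show ?thesis
    unfolding F0_lift_def[abs_def] F0_deriv_def[abs_def] Let_def
    by (intro has_derivative_Pair has_derivative_add has_derivative_fst has_derivative_ident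
        kick_has_derivative)
qed

lemma F0_deriv_inj: "F0_deriv q v = 0 \<Longrightarrow> v = 0"
  by (auto simp: F0_deriv_def Let_def zero_prod_def prod_eq_iff)

lemma continuous_on_F0_deriv: "continuous_on ((cyl_of -` domF) \<times> UNIV) (\<lambda>(q, v). F0_deriv q v)"
proof -
  have "snd (fst x) - 16 * sin (2 * fst (fst x)) \<in> {-1<..<1}"
    if "x \<in> cyl_of -` domF \<times> (UNIV :: (real \<times> real) set)" for x
    using that by (simp add: mem_Times_iff domF_cyl_of abs_less_iff)
  then show ?thesis
    unfolding F0_deriv_def Let_def case_prod_beta
    by (intro continuous_intros continuous_on_compose2[OF continuous_on_drift']) blast+
qed

lemma continuous_on_F0: "continuous_on domF F0"
proof (rule continuous_on_cyl_lift[OF open_domF])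
  have "continuous_on (cyl_of -` domF) F0_lift"
    using F0_lift_has_derivative
    by (meson continuous_at_imp_continuous_on has_derivative_continuous vimageE)
  then show "continuous_on (cyl_of -` domF) (\<lambda>q. F0 (cyl_of q))"
    unfolding F0_cyl_of by (rule continuous_on_compose2[OF continuous_on_cyl_of[of UNIV]]) auto
qed

lemma open_F0_image: "open (F0 ` domF)" and continuous_on_F0_inv: "continuous_on (F0 ` domF) F0_inv"
proof -
  let ?E = "{z :: cyl. \<bar>snd z\<bar> < 1}"
  have E: "open ?E" by (intro open_Collect_less continuous_intros)
  have c: "continuous_on ?E F0_inv"
  proof (rule continuous_on_cyl_lift[OF E])
    have "continuous_on (cyl_of -` ?E) (\<lambda>q. drift (snd q))"
      by (rule continuous_on_compose2[OF continuous_on_drift]) (auto intro!: continuous_intros)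
    then have "continuous_on (cyl_of -` ?E) F0_inv_lift"
      unfolding F0_inv_lift_def[abs_def] Let_def by (intro continuous_intros)
    then show "continuous_on (cyl_of -` ?E) (\<lambda>q. F0_inv (cyl_of q))"
      unfolding F0_inv_cyl_of by (rule continuous_on_compose2[OF continuous_on_cyl_of[of UNIV]]) auto
  qed
  have snd_F0: "snd (F0 z) = kick z" for z by (simp add: F0_def)
  have im: "F0 ` domF = F0_inv -` {z. \<bar>snd z\<bar> < 1} \<inter> ?E"
  proof (intro set_eqI iffI)
    fix z assume "z \<in> F0_inv -` {z. \<bar>snd z\<bar> < 1} \<inter> ?E"
    moreover have "kick (F0_inv z) = snd z" using snd_F0[of "F0_inv z"] by simp
    ultimately have "F0_inv z \<in> domF" by (simp add: domF_def)
    then show "z \<in> F0 ` domF" by (metis F0_F0_inv image_eqI)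
  qed (auto simp: domF_def snd_F0)
  show "open (F0 ` domF)"
    unfolding im by (rule continuous_on_open_vimage[THEN iffD1, rule_format, OF E c E])
  show "continuous_on (F0 ` domF) F0_inv"
    by (rule continuous_on_subset[OF c]) (auto simp: im)
qed

text \<open>
  When \<open>\<bar>cos (2\<theta>)\<bar>\<close> is close to 1 the kick dominates: a vector with \<open>\<bar>dp\<bar> \<le> 2 \<bar>d\<theta>\<bar>\<close> is mapped to one with
  \<open>\<bar>dp\<bar>\<close> at least 28 times the old \<open>\<bar>d\<theta>\<bar>\<close>, and the shear that follows, of strength at least 1, makes
  \<open>\<bar>d\<theta>\<bar>\<close> comparable to \<open>\<bar>dp\<bar>\<close> again.
\<close>

lemma F0_deriv_unstable_cone:
  assumes "\<bar>snd q - 16 * sin (2 * fst q)\<bar> < 1" "24 / 25 \<le> \<bar>cos (2 * fst q)\<bar>" "v \<in> unstable_cone"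
  shows "F0_deriv q v \<in> unstable_cone"
proof -
  define a b g where "a = fst v" and "b = snd v - 32 * cos (2 * fst q) * fst v"
    and "g = drift' (snd q - 16 * sin (2 * fst q))"
  have "24 / 25 * \<bar>a\<bar> \<le> \<bar>cos (2 * fst q)\<bar> * \<bar>a\<bar>" using assms(2) by (intro mult_right_mono) auto
  then have "24 / 25 * \<bar>a\<bar> \<le> \<bar>cos (2 * fst q) * a\<bar>" by (simp add: abs_mult)
  moreover have "\<bar>snd v\<bar> \<le> 2 * \<bar>a\<bar>" using assms(3) by (simp add: unstable_cone_def a_def)
  ultimately have b: "28 * \<bar>a\<bar> \<le> \<bar>b\<bar>" unfolding b_def a_def by linarith
  have "1 * \<bar>b\<bar> \<le> g * \<bar>b\<bar>" using drift'_ge_1[OF assms(1)] unfolding g_def by (intro mult_right_mono) auto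
  also have "g * \<bar>b\<bar> = \<bar>g * b\<bar>" using drift'_ge_1[OF assms(1)] by (simp add: g_def abs_mult)
  finally have "\<bar>b\<bar> \<le> \<bar>g * b\<bar>" by simp
  moreover have "\<bar>g * b\<bar> \<le> \<bar>a + g * b\<bar> + \<bar>a\<bar>" by arith
  moreover have "B \<le> 2 * X" if "B \<le> G" "G \<le> X + A" "28 * A \<le> B" "0 \<le> X" for A B G X :: real
    using that by linarith
  ultimately have "\<bar>b\<bar> \<le> 2 * \<bar>a + g * b\<bar>" using b abs_ge_zero by blast
  then show ?thesis
    by (simp add: F0_deriv_def unstable_cone_def Let_def a_def b_def g_def)
qed

lemma unstable_curve_step:
  assumes curve: "embedded_curve_tangent (Wu_part A U N) z L" "L \<subseteq> unstable_cone"
    and z: "z \<in> domF" "\<And>q. cyl_of q = z \<Longrightarrow> 24 / 25 \<le> \<bar>cos (2 * fst q)\<bar>"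
  shows "\<exists>L'\<subseteq>unstable_cone. embedded_curve_tangent (Wu_part A U (Suc N)) (F0 z) L'"
proof -
  have "\<exists>q. cyl_of q = z \<and>
      embedded_curve_tangent (F0 ` (Wu_part A U N \<inter> domF)) (F0 z) (F0_deriv q ` L)"
    by (rule embedded_curve_tangent_image[OF curve(1) open_domF z(1) continuous_on_F0 open_F0_image
        continuous_on_F0_inv])
       (auto intro: F0_cyl_of[symmetric] F0_lift_has_derivative F0_deriv_inj continuous_on_F0_deriv)
  then obtain q where q: "cyl_of q = z"
    "embedded_curve_tangent (Wu_part A U (Suc N)) (F0 z) (F0_deriv q ` L)"
    unfolding Wu_part_Suc by blast
  have "F0_deriv q ` L \<subseteq> unstable_cone"
    using F0_deriv_unstable_cone[of q] z q(1) curve(2) by (auto simp: domF_cyl_of)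
  then show ?thesis using q(2) by blast
qed

definition reversor_deriv :: "real \<times> real \<Rightarrow> real \<times> real \<Rightarrow> real \<times> real" where
  "reversor_deriv q v = (fst v, 32 * cos (2 * fst q) * fst v - snd v)"

text \<open>
  The derivative of the reversor sends \<open>(d\<theta>, dp)\<close> to \<open>(d\<theta>, 32 cos (2\<theta>) d\<theta> - dp)\<close>, so it maps the
  unstable cone into the stable one.
\<close>

lemma stable_curve_reversor:
  assumes curve: "embedded_curve_tangent (Wu_part A U N) z L" "L \<subseteq> unstable_cone"
    and z: "z \<in> domF" "\<And>q. cyl_of q = z \<Longrightarrow> 24 / 25 \<le> \<bar>cos (2 * fst q)\<bar>"
  shows "\<exists>M\<subseteq>stable_cone. embedded_curve_tangent
           (Ws_part (reversor A) (reversor ` U) N) (reversor z) M"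
proof -
  have "\<exists>q. cyl_of q = z \<and> embedded_curve_tangent
      (reversor ` (Wu_part A U N \<inter> domF)) (reversor z) (reversor_deriv q ` L)"
  proof (rule embedded_curve_tangent_image[OF curve(1) open_domF z(1), where \<Psi> = reversor])
    show "(reversor_lift has_derivative reversor_deriv q) (at q)" for q
      unfolding reversor_lift_def[abs_def] reversor_deriv_def[abs_def]
      by (auto intro!: derivative_eq_intros)
    show "reversor_deriv q v = 0 \<Longrightarrow> v = 0" for q v
      by (auto simp: reversor_deriv_def zero_prod_def prod_eq_iff)
    show "continuous_on (cyl_of -` domF \<times> UNIV) (\<lambda>(q, v). reversor_deriv q v)"
      unfolding reversor_deriv_def case_prod_beta by (intro continuous_intros)
  qed (auto intro!: continuous_on_reversor open_reversor_image open_domF simp: reversor_cyl_of)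
  then obtain q where q: "cyl_of q = z" "embedded_curve_tangent
      (Ws_part (reversor A) (reversor ` U) N) (reversor z) (reversor_deriv q ` L)"
    unfolding Ws_part_reversor by blast
  have "reversor_deriv q v \<in> stable_cone" if "v \<in> L" for v
  proof -
    have "24 / 25 * \<bar>fst v\<bar> \<le> \<bar>cos (2 * fst q)\<bar> * \<bar>fst v\<bar>"
      using z(2)[OF q(1)] by (intro mult_right_mono) auto
    then have "24 / 25 * \<bar>fst v\<bar> \<le> \<bar>cos (2 * fst q) * fst v\<bar>" by (simp add: abs_mult)
    moreover have "\<bar>snd v\<bar> \<le> 2 * \<bar>fst v\<bar>" using curve(2) that by (auto simp: unstable_cone_def)
    ultimately show ?thesis unfolding reversor_deriv_def stable_cone_def by simp
  qed
  then show ?thesis using q(2) by blast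
qed

text \<open>
  A tangent line of an embedded curve contains a nonzero vector, which cannot lie in both cones.
\<close>

lemma unstable_stable_lines_distinct:
  assumes "embedded_curve_tangent S z L" "L \<subseteq> unstable_cone" "M \<subseteq> stable_cone"
  shows "L \<noteq> M"
proof
  assume "L = M"
  obtain v where v: "v \<noteq> 0" "v \<in> L"
    using assms(1) unfolding embedded_curve_tangent_def
    by (metis greaterThanLessThan_iff insertI1 span_base zero_less_one neg_less_0_iff_less)
  then have "\<bar>snd v\<bar> \<le> 2 * \<bar>fst v\<bar>" "28 * \<bar>fst v\<bar> \<le> \<bar>snd v\<bar>"
    using assms(2,3) \<open>L = M\<close> by (auto simp: unstable_cone_def stable_cone_def)
  then show False using v(1) by (auto simp: prod_eq_iff)
qed

section \<open>Divided differences\<close>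

text \<open>
  The points of the heteroclinic orbit have an angle within \<open>1/8\<close> of a multiple of \<open>\<pi>/2\<close>; this bound is
  the source of all the hyperbolicity constants.
\<close>

lemma cos_double_ge:
  fixes x :: real
  assumes "\<bar>x\<bar> \<le> 1 / 8" shows "24 / 25 \<le> cos (2 * x)"
proof -
  have "(sin x)\<^sup>2 \<le> (1 / 8)\<^sup>2"
    using abs_sin_x_le_abs_x[of x] assms by (subst abs_le_square_iff[symmetric]) auto
  then show ?thesis unfolding cos_double_sin by (simp add: power2_eq_square)
qed

text \<open>
  On the diagonal the quotient would be 0; the derivative in its place makes the function continuous.
\<close>

definition divdiff :: "(real \<Rightarrow> real) \<Rightarrow> (real \<Rightarrow> real) \<Rightarrow> real \<Rightarrow> real \<Rightarrow> real" where
  "divdiff f f' s t = (if s = t then f' s else (f s - f t) / (s - t))"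

lemma divdiff_mult: "f s - f t = divdiff f f' s t * (s - t)"
  by (simp add: divdiff_def)

lemma divdiff_mean_value:
  assumes "\<And>x. x \<in> {a..b} \<Longrightarrow> (f has_real_derivative f' x) (at x)" "s \<in> {a..b}" "t \<in> {a..b}"
  shows "\<exists>\<xi>. min s t \<le> \<xi> \<and> \<xi> \<le> max s t \<and> divdiff f f' s t = f' \<xi>"
proof -
  have main: "\<exists>\<xi>. s \<le> \<xi> \<and> \<xi> \<le> t \<and> divdiff f f' s t = f' \<xi>"
    if st: "s < t" "s \<in> {a..b}" "t \<in> {a..b}" for s t
  proof -
    obtain \<xi> where "s < \<xi>" "\<xi> < t" "f t - f s = (t - s) * f' \<xi>"
      using MVT2[OF st(1), of f f'] assms(1) st by auto
    then show ?thesis using st(1) by (intro exI[of _ \<xi>]) (auto simp: divdiff_def field_simps)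
  qed
  have sym: "divdiff f f' s t = divdiff f f' t s"
    by (simp add: divdiff_def) (metis minus_diff_eq minus_divide_divide)
  consider "s < t" | "s = t" | "t < s" by linarith
  then show ?thesis
  proof cases
    case 1
    then show ?thesis using main[OF 1 assms(2,3)] by auto
  next
    case 2
    then show ?thesis by (auto simp: divdiff_def)
  next
    case 3
    then show ?thesis using main[OF 3 assms(3,2)] sym by auto
  qed
qed

text \<open>
  At a point of the diagonal the mean value theorem reduces the continuity of the divided difference to
  that of \<open>f'\<close>.
\<close>

lemma continuous_on_divdiff:
  assumes der: "\<And>x. x \<in> {a..b} \<Longrightarrow> (f has_real_derivative f' x) (at x)"
    and cont: "continuous_on {a..b} f'"
  shows "continuous_on ({a..b} \<times> {a..b}) (\<lambda>(s, t). divdiff f f' s t)"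
  unfolding continuous_on_eq_continuous_within
proof
  let ?S = "{a..b} \<times> {a..b}"
  fix z assume z: "z \<in> ?S"
  obtain s t where st: "z = (s, t)" by (cases z)
  show "continuous (at z within ?S) (\<lambda>(s, t). divdiff f f' s t)"
  proof (cases "s = t")
    case False
    have fc: "continuous_on {a..b} f"
      using der by (meson DERIV_isCont continuous_at_imp_continuous_on)
    have "continuous_on ?S (\<lambda>z. f (fst z))" "continuous_on ?S (\<lambda>z. f (snd z))"
      by (auto intro!: continuous_on_compose2[OF fc] continuous_intros)
    then have lim: "((\<lambda>z. (f (fst z) - f (snd z)) / (fst z - snd z)) \<longlongrightarrow> (f (fst z) - f (snd z)) / (fst z - snd z))
        (at z within ?S)"
      using z False st by (intro tendsto_intros) (auto simp: continuous_on_def)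
    have "open {z :: real \<times> real. fst z \<noteq> snd z}" by (intro open_Collect_neq continuous_intros)
    then have "\<forall>\<^sub>F z in at z within ?S. fst z \<noteq> snd z"
      using False st unfolding eventually_at_topological by fastforce
    then have ev: "\<forall>\<^sub>F z in at z within ?S.
        (f (fst z) - f (snd z)) / (fst z - snd z) = (case z of (s, t) \<Rightarrow> divdiff f f' s t)"
      by eventually_elim (auto simp: divdiff_def split: prod.split)
    have eq: "(f (fst z) - f (snd z)) / (fst z - snd z) = (case z of (s, t) \<Rightarrow> divdiff f f' s t)"
      using False by (simp add: st divdiff_def)
    show ?thesis
      unfolding continuous_within by (rule Lim_transform_eventually[OF lim[unfolded eq] ev])
  next
    case True
    have s: "s \<in> {a..b}" using z st by auto
    show ?thesis
      unfolding continuous_within_eps_delta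
    proof (intro allI impI)
      fix e :: real assume "e > 0"
      then obtain d where d: "d > 0" "\<And>x. x \<in> {a..b} \<Longrightarrow> \<bar>x - s\<bar> < d \<Longrightarrow> \<bar>f' x - f' s\<bar> < e"
        using cont s unfolding continuous_on_iff dist_real_def by blast
      have "dist (case y of (s, t) \<Rightarrow> divdiff f f' s t) (case z of (s, t) \<Rightarrow> divdiff f f' s t) < e"
        if y: "y \<in> ?S" "dist y z < d" for y
      proof -
        obtain s' t' where y': "y = (s', t')" by (cases y)
        have "\<bar>s' - s\<bar> < d" "\<bar>t' - s\<bar> < d"
          using y(2) dist_fst_le[of y z] dist_snd_le[of y z] True by (auto simp: y' st dist_real_def)
        moreover obtain \<xi> where \<xi>: "min s' t' \<le> \<xi>" "\<xi> \<le> max s' t'" "divdiff f f' s' t' = f' \<xi>"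
          using divdiff_mean_value[of a b f f' s' t'] der y(1) y' by auto
        moreover have "\<xi> \<in> {a..b}" using \<xi>(1,2) y(1) by (auto simp: y')
        ultimately have "\<bar>f' \<xi> - f' s\<bar> < e" by (intro d(2)) auto
        then show ?thesis using \<xi>(3) True by (simp add: y' st dist_real_def divdiff_def)
      qed
      then show "\<exists>d>0. \<forall>y\<in>?S. dist y z < d \<longrightarrow>
          dist (case y of (s, t) \<Rightarrow> divdiff f f' s t) (case z of (s, t) \<Rightarrow> divdiff f f' s t) < e"
        using d(1) by blast
    qed
  qed
qed

text \<open>
  The recurrence for the angles combines \<^const>\<open>drift_inv\<close> at differences of angles with \<open>sin (2 x)\<close>. Their
  divided differences are estimated on \<open>[-1, 1]\<close>, which contains all differences of angles near a saddle
  and lies inside \<open>(-2\<pi>/3, 2\<pi>/3)\<close>, and on \<open>[-1/8, 1/8]\<close>.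
\<close>

definition drift_inv_dd :: "real \<Rightarrow> real \<Rightarrow> real" where
  "drift_inv_dd = divdiff drift_inv drift_inv'"

definition sin2_dd :: "real \<Rightarrow> real \<Rightarrow> real" where
  "sin2_dd = divdiff (\<lambda>x. sin (2 * x)) (\<lambda>x. 2 * cos (2 * x))"

lemma abs_less_drift_range: "x \<in> {-1..1} \<Longrightarrow> \<bar>x\<bar> < 2 * pi / 3" for x :: real
  using pi_gt3 by auto

lemma drift_inv_dd_bounds:
  assumes "s \<in> {-1..1}" "t \<in> {-1..1}"
  shows "0 < drift_inv_dd s t" "drift_inv_dd s t \<le> 1"
proof -
  obtain \<xi> where \<xi>: "min s t \<le> \<xi>" "\<xi> \<le> max s t" "drift_inv_dd s t = drift_inv' \<xi>"
    using divdiff_mean_value[of "-1" 1 drift_inv drift_inv' s t]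
      drift_inv_has_derivative abs_less_drift_range assms unfolding drift_inv_dd_def by blast
  then have "\<xi> \<in> {-1..1}" using assms by auto
  then show "0 < drift_inv_dd s t" "drift_inv_dd s t \<le> 1"
    unfolding \<xi>(3) by (auto intro!: drift_inv'_bounds abs_less_drift_range)
qed

lemma drift_inv_dd_mult: "drift_inv s - drift_inv t = drift_inv_dd s t * (s - t)"
  unfolding drift_inv_dd_def by (rule divdiff_mult)

lemma drift_inv_lipschitz:
  assumes "s \<in> {-1..1}" "t \<in> {-1..1}"
  shows "\<bar>drift_inv s - drift_inv t\<bar> \<le> \<bar>s - t\<bar>"
  using drift_inv_dd_bounds[OF assms] mult_right_mono[of "drift_inv_dd s t" 1 "\<bar>s - t\<bar>"]
  by (simp add: drift_inv_dd_mult abs_mult)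

lemma sin2_has_derivative:
  "((\<lambda>x. sin (2 * x)) has_real_derivative 2 * cos (2 * x)) (at (x::real))"
  by (auto intro!: derivative_eq_intros)

lemma sin2_dd_bounds:
  assumes "\<bar>s\<bar> \<le> 1 / 8" "\<bar>t\<bar> \<le> 1 / 8"
  shows "48 / 25 \<le> sin2_dd s t" "sin2_dd s t \<le> 2"
proof -
  have "s \<in> {-1/8..1/8}" "t \<in> {-1/8..1/8}" using assms by auto
  then obtain \<xi> where \<xi>: "min s t \<le> \<xi>" "\<xi> \<le> max s t" "sin2_dd s t = 2 * cos (2 * \<xi>)"
    using divdiff_mean_value[of "-1/8" "1/8", OF sin2_has_derivative, of s t]
    unfolding sin2_dd_def by blast
  then have "\<bar>\<xi>\<bar> \<le> 1 / 8" using assms by auto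
  from cos_double_ge[OF this] show "48 / 25 \<le> sin2_dd s t" "sin2_dd s t \<le> 2"
    unfolding \<xi>(3) by auto
qed

lemma sin2_dd_mult: "sin (2 * s) - sin (2 * t) = sin2_dd s t * (s - t)"
  unfolding sin2_dd_def by (rule divdiff_mult)

lemma sin2_expanding:
  fixes s t :: real
  assumes "\<bar>s\<bar> \<le> 1 / 8" "\<bar>t\<bar> \<le> 1 / 8"
  shows "48 / 25 * \<bar>s - t\<bar> \<le> \<bar>sin (2 * s) - sin (2 * t)\<bar>"
  using sin2_dd_bounds[OF assms] mult_right_mono[of "48/25" "sin2_dd s t" "\<bar>s - t\<bar>"]
  by (simp add: sin2_dd_mult abs_mult)

section \<open>Backward orbits close to a saddle\<close>

text \<open>
  Near the saddle with angle \<open>a\<close>, where \<open>c = cos (2 a)\<close> is \<open>1\<close> or \<open>-1\<close>, a backward orbit with angles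
  \<open>a + v k\<close> (the index \<open>k\<close> counts backward steps) is the same thing as a sequence \<open>v\<close> with
  \<open>P (v\<^sub>k\<^sub>+\<^sub>1 - v\<^sub>k\<^sub>+\<^sub>2) - P (v\<^sub>k - v\<^sub>k\<^sub>+\<^sub>1) = 16 c sin (2 v\<^sub>k\<^sub>+\<^sub>1)\<close>, since the momentum is determined by
  consecutive angles. In this form no momentum occurs and the estimates are those of a scalar
  three-term recurrence.
\<close>

definition local_seq :: "real \<Rightarrow> (nat \<Rightarrow> real) \<Rightarrow> bool" where
  "local_seq c v \<longleftrightarrow> (\<forall>k. \<bar>v k\<bar> \<le> 1 / 8) \<and>
     (\<forall>k. drift_inv (v (Suc k) - v (Suc (Suc k))) - drift_inv (v k - v (Suc k))
          = 16 * c * sin (2 * v (Suc k)))"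

lemma local_seq_bound: "local_seq c v \<Longrightarrow> \<bar>v k\<bar> \<le> 1 / 8"
  by (simp add: local_seq_def)

lemma local_seq_0: "local_seq c (\<lambda>_. 0)"
  by (simp add: local_seq_def)

text \<open>
  A discrete maximum principle: the two neighbours enter with a small weight, so a bounded
  solution cannot grow away from its boundary value.
\<close>

lemma three_term_decay:
  fixes D :: "nat \<Rightarrow> real"
  assumes D: "\<And>k. 0 \<le> D k" "\<And>k. D k \<le> B" "\<And>k. 28 * D (Suc k) \<le> D k + D (Suc (Suc k))"
  shows "D 1 \<le> D 0 / 4"
proof -
  define M where "M = (SUP k. D (Suc k))"
  have M: "D (Suc k) \<le> M" for k
    unfolding M_def using D(2) by (intro cSUP_upper) (auto intro!: bdd_aboveI[of _ B])
  have M0: "0 \<le> M" using M[of 0] D(1)[of 1] by simp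
  have Dk: "D k \<le> D 0 + M" for k
    using M D(1)[of 0] M0 by (cases k) (auto intro: order_trans[OF M])
  have "D (Suc k) \<le> (D 0 + 2 * M) / 28" for k
    using D(3)[of k] M[of "Suc k"] Dk[of k] by simp
  then have "M \<le> (D 0 + 2 * M) / 28" unfolding M_def[symmetric]
    by (subst M_def) (intro cSUP_least; simp)
  then show ?thesis using M[of 0] D(1)[of 0] by simp
qed

text \<open>
  For two solutions the sine on the right expands their distance by at least \<open>16 \<sqdot> 48/25 > 30\<close>, while
  \<^const>\<open>drift_inv\<close> is 1-Lipschitz, which leaves the coefficient 28 of the maximum principle.
\<close>

lemma local_seq_contract:
  assumes c: "\<bar>c\<bar> = 1" and v: "local_seq c v" and w: "local_seq c w"
  shows "\<bar>v (Suc k) - w (Suc k)\<bar> \<le> \<bar>v k - w k\<bar> / 4"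
proof -
  have main: "\<bar>v 1 - w 1\<bar> \<le> \<bar>v 0 - w 0\<bar> / 4" if v: "local_seq c v" and w: "local_seq c w" for v w
  proof (rule three_term_decay[of "\<lambda>k. \<bar>v k - w k\<bar>" "1/4"])
    have b: "\<bar>v k\<bar> \<le> 1 / 8" "\<bar>w k\<bar> \<le> 1 / 8" for k using v w local_seq_bound by blast+
    show "\<bar>v k - w k\<bar> \<le> 1 / 4" for k using b[of k] by linarith
    fix k
    have r: "u k - u (Suc k) \<in> {-1..1}" if "u = v \<or> u = w" for u k
      using that b[of k] b[of "Suc k"] by auto
    have L: "\<bar>drift_inv (v k - v (Suc k)) - drift_inv (w k - w (Suc k))\<bar>
        \<le> \<bar>v k - w k\<bar> + \<bar>v (Suc k) - w (Suc k)\<bar>" for k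
      using drift_inv_lipschitz[OF r r, of v w k k] by auto
    have eq: "16 * c * (sin (2 * v (Suc k)) - sin (2 * w (Suc k)))
        = (drift_inv (v (Suc k) - v (Suc (Suc k))) - drift_inv (w (Suc k) - w (Suc (Suc k))))
        - (drift_inv (v k - v (Suc k)) - drift_inv (w k - w (Suc k)))"
    proof -
      have "drift_inv (u (Suc k) - u (Suc (Suc k))) - drift_inv (u k - u (Suc k))
          = 16 * c * sin (2 * u (Suc k))" if "u = v \<or> u = w" for u
        using that v w unfolding local_seq_def by blast
      from this[OF disjI1[OF refl]] this[OF disjI2[OF refl]]
      show ?thesis unfolding right_diff_distrib by linarith
    qed
    have "\<bar>16 * c * (sin (2 * v (Suc k)) - sin (2 * w (Suc k)))\<bar>
        \<le> (\<bar>v (Suc k) - w (Suc k)\<bar> + \<bar>v (Suc (Suc k)) - w (Suc (Suc k))\<bar>)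
          + (\<bar>v k - w k\<bar> + \<bar>v (Suc k) - w (Suc k)\<bar>)"
      unfolding eq by (rule order_trans[OF abs_triangle_ineq4 add_mono[OF L L]])
    moreover have "\<bar>16 * c * (sin (2 * v (Suc k)) - sin (2 * w (Suc k)))\<bar>
        = 16 * \<bar>sin (2 * v (Suc k)) - sin (2 * w (Suc k))\<bar>"
      using c by (simp add: abs_mult)
    ultimately show "28 * \<bar>v (Suc k) - w (Suc k)\<bar> \<le> \<bar>v k - w k\<bar> + \<bar>v (Suc (Suc k)) - w (Suc (Suc k))\<bar>"
      using sin2_expanding[OF b[of "Suc k"]] abs_ge_zero[of "v (Suc k) - w (Suc k)"] by linarith
  qed simp
  have sh: "local_seq c v \<Longrightarrow> local_seq c (\<lambda>j. v (j + k))" for v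
    by (simp add: local_seq_def)
  from main[OF sh[OF v] sh[OF w]] show ?thesis by simp
qed

lemma local_seq_unique:
  assumes "\<bar>c\<bar> = 1" "local_seq c v" "local_seq c w" "v 0 = w 0" shows "v = w"
proof
  fix k show "v k = w k"
  proof (induction k)
    case (Suc k)
    then show ?case using local_seq_contract[OF assms(1-3), of k] by simp
  qed (rule assms(4))
qed

text \<open>
  Solving the recurrence for the angle inside the sine gives a fixed-point equation \<open>G v = v\<close> for the
  sequence, in which the value at 0 is prescribed. The operator \<open>G\<close> contracts the supremum distance by
  \<open>1/4\<close>, and the iteration from 0 converges uniformly.
\<close>

lemma local_seq_exists:
  assumes c: "\<bar>c\<bar> = 1" and x: "\<bar>x\<bar> \<le> 1 / 8"
  shows "\<exists>v. local_seq c v \<and> v 0 = x"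
proof -
  define Y where "Y v j = (drift_inv (v (Suc j) - v (Suc (Suc j))) - drift_inv (v j - v (Suc j))) / 16"
    for v :: "nat \<Rightarrow> real" and j
  define G where "G v k = (case k of 0 \<Rightarrow> x | Suc j \<Rightarrow> c / 2 * arcsin (Y v j))"
    for v :: "nat \<Rightarrow> real" and k
  \<comment> \<open>\<open>c / 2 * arcsin\<close> differs from \<open>arcsin / 2\<close> by a sign only\<close>
  have half: "\<bar>c / 2 * a\<bar> = \<bar>a / 2\<bar>" for a using c by (simp add: abs_mult)
  have quarter: "1 / 32 \<le> sin (1 / 4 :: real)"
    using sin2_dd_bounds(1)[of "1/8" 0] sin2_dd_mult[of "1/8" 0] by simp
  have arcsin_bd: "\<bar>arcsin y / 2\<bar> \<le> 1 / 8" if "\<bar>y\<bar> \<le> 1 / 32" for y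
  proof -
    have "arcsin y \<le> arcsin (sin (1 / 4))" "arcsin (- sin (1 / 4)) \<le> arcsin y"
      using that quarter by (intro arcsin_le_arcsin; simp; linarith)+
    moreover have "arcsin (sin (1 / 4)) = 1 / 4" using pi_gt3 by (intro arcsin_sin) auto
    ultimately show ?thesis using arcsin_minus[of "sin (1 / 4)"] by auto
  qed
  have sin_arc: "sin (2 * (arcsin y / 2)) = y" if "\<bar>y\<bar> \<le> 1 / 32" for y
    using that by (simp add: abs_le_iff)
  have arcsin_lip: "\<bar>arcsin y / 2 - arcsin z / 2\<bar> \<le> \<bar>y - z\<bar>" if "\<bar>y\<bar> \<le> 1 / 32" "\<bar>z\<bar> \<le> 1 / 32" for y z
  proof -
    have "48 / 25 * \<bar>arcsin y / 2 - arcsin z / 2\<bar> \<le> \<bar>y - z\<bar>"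
      using sin2_expanding[OF arcsin_bd[OF that(1)] arcsin_bd[OF that(2)]]
      unfolding sin_arc[OF that(1)] sin_arc[OF that(2)] .
    moreover have "a \<le> b" if "48 / 25 * a \<le> b" "0 \<le> a" for a b :: real
      using that by linarith
    ultimately show ?thesis using abs_ge_zero by blast
  qed
  have diff_bd: "\<bar>v j - v (Suc j)\<bar> \<le> 1 / 4" if "\<And>k. \<bar>v k\<bar> \<le> 1 / 8" for v :: "nat \<Rightarrow> real" and j
    using that[of j] that[of "Suc j"] by linarith
  have diff_range: "v j - v (Suc j) \<in> {-1..1}" if "\<And>k. \<bar>v k\<bar> \<le> 1 / 8" for v :: "nat \<Rightarrow> real" and j
    using diff_bd[of v j, OF that] unfolding atLeastAtMost_iff by (intro conjI; linarith)
  have Y_bd: "\<bar>Y v j\<bar> \<le> 1 / 32" if v: "\<And>k. \<bar>v k\<bar> \<le> 1 / 8" for v j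
  proof -
    have bd: "\<bar>drift_inv (v i - v (Suc i))\<bar> \<le> 1 / 4" for i
      using drift_inv_lipschitz[of "v i - v (Suc i)" 0] diff_range[of v i, OF v] diff_bd[of v i, OF v] by simp
    from order_trans[OF abs_triangle_ineq4 add_mono[OF bd[of "Suc j"] bd[of j]]]
    show ?thesis unfolding Y_def abs_divide by simp
  qed
  have G_bd: "\<bar>G v k\<bar> \<le> 1 / 8" if "\<And>k. \<bar>v k\<bar> \<le> 1 / 8" for v k
    unfolding G_def using x half arcsin_bd[OF Y_bd[OF that]] by (simp split: nat.split)
  have Y_lip: "\<bar>Y v j - Y w j\<bar> \<le> d / 4"
    if v: "\<And>k. \<bar>v k\<bar> \<le> 1 / 8" and w: "\<And>k. \<bar>w k\<bar> \<le> 1 / 8" and d: "\<And>k. \<bar>v k - w k\<bar> \<le> d" for v w j d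
  proof -
    have bd: "\<bar>drift_inv (v i - v (Suc i)) - drift_inv (w i - w (Suc i))\<bar> \<le> 2 * d" for i
      using drift_inv_lipschitz[OF diff_range[of v i, OF v] diff_range[of w i, OF w]]
        d[of i] d[of "Suc i"] by linarith
    show ?thesis
      using bd[of j, THEN abs_le_D1] bd[of j, THEN abs_le_D2]
        bd[of "Suc j", THEN abs_le_D1] bd[of "Suc j", THEN abs_le_D2]
      unfolding Y_def diff_divide_distrib by (intro abs_leI) linarith+
  qed
  have G_lip: "\<bar>G v k - G w k\<bar> \<le> d / 4"
    if v: "\<And>k. \<bar>v k\<bar> \<le> 1 / 8" and w: "\<And>k. \<bar>w k\<bar> \<le> 1 / 8" and d: "\<And>k. \<bar>v k - w k\<bar> \<le> d" for v w k d
  proof (cases k)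
    case 0
    then show ?thesis using d[of 0] unfolding G_def by simp
  next
    case (Suc j)
    have "\<bar>G v k - G w k\<bar> = \<bar>arcsin (Y v j) / 2 - arcsin (Y w j) / 2\<bar>"
      using half[of "arcsin (Y v j) - arcsin (Y w j)"] by (simp add: Suc G_def algebra_simps diff_divide_distrib)
    also have "\<dots> \<le> \<bar>Y v j - Y w j\<bar>" by (intro arcsin_lip Y_bd v w)
    also have "\<dots> \<le> d / 4" by (rule Y_lip[OF v w d])
    finally show ?thesis .
  qed
  define V where "V n = (G ^^ n) (\<lambda>_. 0)" for n
  have V_bd: "\<bar>V n k\<bar> \<le> 1 / 8" for n k
    unfolding V_def by (induction n arbitrary: k) (simp, simp only: funpow.simps o_apply G_bd)
  have V_cauchy: "\<bar>V (n + m) k - V n k\<bar> \<le> (1 / 4) ^ Suc n" for n m k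
  proof (induction n arbitrary: k)
    case 0
    show ?case using V_bd[of m k] by (simp add: V_def)
  next
    case (Suc n)
    from G_lip[OF V_bd V_bd Suc] show ?case by (simp add: V_def)
  qed
  have "Cauchy (\<lambda>n. V n k)" for k
  proof (rule CauchyI')
    fix e :: real assume "e > 0"
    then obtain M where M: "(1 / 4) ^ M < e" using real_arch_pow_inv[of e "1/4"] by auto
    have "dist (V m k) (V n k) < e" if "m \<ge> M" "n > m" for m n
    proof -
      have "\<bar>V n k - V m k\<bar> \<le> (1 / 4) ^ Suc m" using V_cauchy[of m "n - m" k] that by simp
      also have "\<dots> \<le> (1 / 4) ^ M" using that by (intro power_decreasing) auto
      finally show ?thesis using M by (simp add: dist_real_def abs_minus_commute)
    qed
    then show "\<exists>M. \<forall>m\<ge>M. \<forall>n>m. dist (V m k) (V n k) < e" by blast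
  qed
  then obtain v where v: "\<And>k. (\<lambda>n. V n k) \<longlonglongrightarrow> v k"
    unfolding Cauchy_convergent_iff convergent_def by metis
  have v_bd: "\<bar>v k\<bar> \<le> 1 / 8" for k
    by (rule LIMSEQ_le_const2[OF tendsto_rabs[OF v]]) (use V_bd in auto)
  have v_approx: "\<bar>v k - V n k\<bar> \<le> (1 / 4) ^ Suc n" for n k
  proof (rule LIMSEQ_le_const2)
    show "(\<lambda>m. \<bar>V (m + n) k - V n k\<bar>) \<longlonglongrightarrow> \<bar>v k - V n k\<bar>"
      by (intro tendsto_intros LIMSEQ_ignore_initial_segment v)
  qed (use V_cauchy[of n _ k] in \<open>auto simp: add.commute\<close>)
  have fp: "G v = v"
  proof
    fix k
    have "\<forall>n. norm (G v k - V (Suc n) k) \<le> (1 / 4) ^ Suc n / 4"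
      using G_lip[OF v_bd V_bd v_approx] by (simp add: V_def)
    moreover have "(\<lambda>n. (1 / 4 :: real) ^ Suc n / 4) \<longlonglongrightarrow> 0"
      by (intro tendsto_divide_zero LIMSEQ_Suc LIMSEQ_power_zero) simp
    ultimately have "(\<lambda>n. G v k - V (Suc n) k) \<longlonglongrightarrow> 0"
      by (rule Lim_null_comparison[OF always_eventually])
    moreover have "(\<lambda>n. G v k - V (Suc n) k) \<longlonglongrightarrow> G v k - v k"
      by (rule tendsto_diff[OF tendsto_const LIMSEQ_Suc[OF v]])
    ultimately have "G v k - v k = 0" by (rule LIMSEQ_unique[symmetric])
    then show "G v k = v k" by simp
  qed
  have "drift_inv (v (Suc k) - v (Suc (Suc k))) - drift_inv (v k - v (Suc k))
          = 16 * c * sin (2 * v (Suc k))" for k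
  proof -
    have Yk: "\<bar>Y v k\<bar> \<le> 1 / 32" by (intro Y_bd v_bd)
    have "2 * v (Suc k) = c * arcsin (Y v k)"
      by (subst fp[symmetric]) (simp add: G_def)
    moreover have "sin (c * a) = c * sin a" for a using c by (auto simp: abs_if split: if_splits)
    ultimately have "c * sin (2 * v (Suc k)) = c * (c * Y v k)" using sin_arc[OF Yk] by simp
    also have "c * (c * Y v k) = Y v k" using c by (auto simp: abs_if split: if_splits)
    finally show ?thesis by (simp add: Y_def)
  qed
  moreover have "v 0 = x" by (subst fp[symmetric]) (simp add: G_def)
  ultimately show ?thesis using v_bd unfolding local_seq_def by blast
qed

section \<open>Smoothness of the dynamics on the local unstable curve\<close>

text \<open>
  The dynamics on the local unstable curve, in the coordinate \<open>x = \<theta> - a\<close> and backwards in time.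
  Existence and uniqueness of the sequence for each \<open>\<bar>x\<bar> \<le> 1/8\<close> make it a contraction of \<open>[-1/8, 1/8]\<close>.
\<close>

definition backstep :: "real \<Rightarrow> real \<Rightarrow> real" where
  "backstep c x = (SOME v. local_seq c v \<and> v 0 = x) 1"

lemma local_seq_backstep:
  assumes c: "\<bar>c\<bar> = 1" and v: "local_seq c v"
  shows "v (Suc k) = backstep c (v k)"
proof -
  let ?w = "\<lambda>j. v (j + k)"
  have w: "local_seq c ?w \<and> ?w 0 = v k"
    using v by (simp add: local_seq_def)
  have "(SOME w. local_seq c w \<and> w 0 = v k) = ?w"
    using w local_seq_unique[OF c] by (intro some_equality) auto
  then show ?thesis by (simp add: backstep_def)
qed

lemma backstep_properties:
  assumes c: "\<bar>c\<bar> = 1" and x: "\<bar>x\<bar> \<le> 1 / 8"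
  shows abs_backstep: "\<bar>backstep c x\<bar> \<le> \<bar>x\<bar> / 4"
    and backstep_eq: "drift_inv (backstep c x - backstep c (backstep c x)) - drift_inv (x - backstep c x)
            = 16 * c * sin (2 * backstep c x)"
proof -
  obtain v where v: "local_seq c v" "v 0 = x" using local_seq_exists[OF c x] by blast
  have v1: "v (Suc 0) = backstep c x" using local_seq_backstep[OF c v(1), of 0] v(2) by simp
  have v2: "v (Suc (Suc 0)) = backstep c (backstep c x)" using local_seq_backstep[OF c v(1), of 1] v1 by simp
  show "drift_inv (backstep c x - backstep c (backstep c x)) - drift_inv (x - backstep c x)
            = 16 * c * sin (2 * backstep c x)"
    using v unfolding local_seq_def by (metis v1 v2)
  show "\<bar>backstep c x\<bar> \<le> \<bar>x\<bar> / 4"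
    using local_seq_contract[OF c v(1) local_seq_0, of 0] v1 v(2) by simp
qed

lemma backstep_contract:
  assumes c: "\<bar>c\<bar> = 1" and x: "\<bar>x\<bar> \<le> 1 / 8" and y: "\<bar>y\<bar> \<le> 1 / 8"
  shows "\<bar>backstep c x - backstep c y\<bar> \<le> \<bar>x - y\<bar> / 4"
proof -
  obtain v w where v: "local_seq c v" "v 0 = x" and w: "local_seq c w" "w 0 = y"
    using local_seq_exists[OF c x] local_seq_exists[OF c y] by blast
  then show ?thesis
    using local_seq_contract[OF c v(1) w(1), of 0] local_seq_backstep[OF c v(1), of 0]
      local_seq_backstep[OF c w(1), of 0] by simp
qed

lemma abs_backstep_le:
  assumes "\<bar>c\<bar> = 1" "\<bar>x\<bar> \<le> 1 / 8" shows "\<bar>backstep c x\<bar> \<le> 1 / 8"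
  using abs_backstep[OF assms] assms(2) by linarith

lemma local_seq_iterate_backstep:
  assumes c: "\<bar>c\<bar> = 1" and x: "\<bar>x\<bar> \<le> 1 / 8"
  shows "local_seq c (\<lambda>k. (backstep c ^^ k) x)"
proof -
  obtain v where v: "local_seq c v" "v 0 = x" using local_seq_exists[OF c x] by blast
  have "v k = (backstep c ^^ k) x" for k
    by (induction k) (simp_all add: v(2) local_seq_backstep[OF c v(1)])
  then show ?thesis using v(1) by presburger
qed

lemma local_seq_tendsto_0:
  assumes c: "\<bar>c\<bar> = 1" and v: "local_seq c v"
  shows "v \<longlonglongrightarrow> 0"
proof -
  have bd: "\<bar>v k\<bar> \<le> (1 / 4) ^ k" for k
  proof (induction k)
    case 0
    then show ?case using local_seq_bound[OF v, of 0] by simp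
  next
    case (Suc k)
    have "\<bar>v (Suc k)\<bar> \<le> \<bar>v k\<bar> / 4"
      unfolding local_seq_backstep[OF c v] by (rule abs_backstep[OF c local_seq_bound[OF v]])
    then show ?case using Suc by simp
  qed
  show ?thesis
    by (rule Lim_null_comparison[OF always_eventually LIMSEQ_power_zero[of "1/4 :: real"]])
       (use bd in simp_all)
qed

lemma continuous_on_backstep:
  assumes "\<bar>c\<bar> = 1" shows "continuous_on {-1/8..1/8} (backstep c)"
  unfolding continuous_on_iff dist_real_def
proof (intro ballI allI impI)
  fix x e :: real assume x: "x \<in> {-1/8..1/8}" and e: "0 < e"
  have "\<bar>backstep c y - backstep c x\<bar> < e" if y: "y \<in> {-1/8..1/8}" "\<bar>y - x\<bar> < e" for y
  proof -
    have "\<bar>y\<bar> \<le> 1 / 8" "\<bar>x\<bar> \<le> 1 / 8" using x y(1) by auto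
    note backstep_contract[OF assms this]
    also have "\<bar>y - x\<bar> / 4 \<le> \<bar>y - x\<bar>" by simp
    also note y(2)
    finally show ?thesis .
  qed
  then show "\<exists>d>0. \<forall>y\<in>{-1/8..1/8}. \<bar>y - x\<bar> < d \<longrightarrow> \<bar>backstep c y - backstep c x\<bar> < e"
    using e by blast
qed

text \<open>
  Subtracting the recurrence at two points \<open>x\<close> and \<open>y\<close> and dividing by \<open>x - y\<close> expresses the slope of the
  chord of \<^const>\<open>backstep\<close> over \<open>x, y\<close> through the slope \<open>D\<close> of the chord over their images. All coefficients
  are divided differences, which make sense on the diagonal as well; there the same formula is the
  transformation of slopes of tangents.
\<close>

definition drift_inv_slope :: "real \<Rightarrow> real \<Rightarrow> real \<Rightarrow> real" where
  "drift_inv_slope c x y = drift_inv_dd (x - backstep c x) (y - backstep c y)"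

definition chord_denom :: "real \<Rightarrow> real \<Rightarrow> real \<Rightarrow> real \<Rightarrow> real" where
  "chord_denom c D x y = drift_inv_slope c (backstep c x) (backstep c y) * (1 - D) + drift_inv_slope c x y
     - 16 * c * sin2_dd (backstep c x) (backstep c y)"

definition chord_step :: "real \<Rightarrow> real \<Rightarrow> real \<Rightarrow> real \<Rightarrow> real" where
  "chord_step c D x y = drift_inv_slope c x y / chord_denom c D x y"

definition chord :: "real \<Rightarrow> real \<Rightarrow> real \<Rightarrow> real" where
  "chord c x y = (backstep c x - backstep c y) / (x - y)"

primrec chord_approx :: "real \<Rightarrow> nat \<Rightarrow> real \<Rightarrow> real \<Rightarrow> real" where
  "chord_approx c 0 x y = 0"
| "chord_approx c (Suc n) x y = chord_step c (chord_approx c n (backstep c x) (backstep c y)) x y"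

context
  fixes c :: real
  assumes c: "\<bar>c\<bar> = 1"
begin

lemma backstep_diff_range: "\<bar>x\<bar> \<le> 1 / 8 \<Longrightarrow> x - backstep c x \<in> {-1..1}"
  using abs_backstep_le[OF c, of x] by auto

lemma drift_inv_slope_bounds:
  assumes "\<bar>x\<bar> \<le> 1 / 8" "\<bar>y\<bar> \<le> 1 / 8"
  shows "0 < drift_inv_slope c x y" "drift_inv_slope c x y \<le> 1"
  using drift_inv_dd_bounds[OF backstep_diff_range backstep_diff_range, of x y] assms
  by (simp_all add: drift_inv_slope_def)

text \<open>
  The sine term is at least \<open>16 \<sqdot> 48/25 > 30\<close> in absolute value, the other two terms are at most \<open>5/4\<close> and \<open>1\<close>.
\<close>

lemma chord_denom_bound:
  assumes xy: "\<bar>x\<bar> \<le> 1 / 8" "\<bar>y\<bar> \<le> 1 / 8" and D: "\<bar>D\<bar> \<le> 1 / 4"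
  shows "28 \<le> \<bar>chord_denom c D x y\<bar>"
proof -
  define \<alpha> where "\<alpha> = drift_inv_slope c (backstep c x) (backstep c y)"
  have b: "\<bar>backstep c x\<bar> \<le> 1 / 8" "\<bar>backstep c y\<bar> \<le> 1 / 8" using abs_backstep_le[OF c] xy by auto
  have "\<bar>\<alpha> * (1 - D)\<bar> = \<alpha> * \<bar>1 - D\<bar>"
    using drift_inv_slope_bounds[OF b] by (simp add: abs_mult \<alpha>_def)
  also have "\<dots> \<le> 1 * (5 / 4)"
    using drift_inv_slope_bounds[OF b] D by (intro mult_mono) (auto simp: \<alpha>_def)
  finally have 1: "\<bar>\<alpha> * (1 - D)\<bar> \<le> 5 / 4" by simp
  have 2: "\<bar>16 * c * sin2_dd (backstep c x) (backstep c y)\<bar> = 16 * sin2_dd (backstep c x) (backstep c y)"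
    using sin2_dd_bounds[OF b] c by (simp add: abs_mult)
  show ?thesis
    using 1 2 drift_inv_slope_bounds[OF xy] sin2_dd_bounds(1)[OF b]
    unfolding chord_denom_def \<alpha>_def[symmetric] by linarith
qed

lemma abs_chord_step:
  assumes xy: "\<bar>x\<bar> \<le> 1 / 8" "\<bar>y\<bar> \<le> 1 / 8" and D: "\<bar>D\<bar> \<le> 1 / 4"
  shows "\<bar>chord_step c D x y\<bar> \<le> 1 / 4"
proof -
  have "\<bar>chord_step c D x y\<bar> = drift_inv_slope c x y / \<bar>chord_denom c D x y\<bar>"
    using drift_inv_slope_bounds[OF xy] by (simp add: chord_step_def abs_divide)
  also have "\<dots> \<le> 1 / 28"
    using drift_inv_slope_bounds[OF xy] chord_denom_bound[OF xy D] by (intro frac_le) auto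
  finally show ?thesis by simp
qed

lemma chord_step_contract:
  assumes xy: "\<bar>x\<bar> \<le> 1 / 8" "\<bar>y\<bar> \<le> 1 / 8" and D: "\<bar>D\<bar> \<le> 1 / 4" "\<bar>D'\<bar> \<le> 1 / 4"
  shows "\<bar>chord_step c D x y - chord_step c D' x y\<bar> \<le> \<bar>D - D'\<bar> / 4"
proof -
  define \<alpha> \<beta> E E' where "\<alpha> = drift_inv_slope c (backstep c x) (backstep c y)"
    and "\<beta> = drift_inv_slope c x y" and "E = chord_denom c D x y" and "E' = chord_denom c D' x y"
  have b: "\<bar>backstep c x\<bar> \<le> 1 / 8" "\<bar>backstep c y\<bar> \<le> 1 / 8" using abs_backstep_le[OF c] xy by auto
  have E: "28 \<le> \<bar>E\<bar>" "28 \<le> \<bar>E'\<bar>" unfolding E_def E'_def using chord_denom_bound xy D by auto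
  have diff: "E' - E = \<alpha> * (D - D')"
    by (simp add: E_def E'_def chord_denom_def \<alpha>_def algebra_simps)
  have ab: "0 \<le> \<alpha>" "\<alpha> \<le> 1" "0 \<le> \<beta>" "\<beta> \<le> 1"
    using drift_inv_slope_bounds[OF b] drift_inv_slope_bounds[OF xy] by (auto simp: \<alpha>_def \<beta>_def)
  have "chord_step c D x y - chord_step c D' x y = \<beta> / E - \<beta> / E'"
    by (simp add: chord_step_def \<beta>_def E_def E'_def)
  also have "\<dots> = \<beta> * (E' - E) / (E * E')"
    using E by (simp add: diff_frac_eq right_diff_distrib)
  also have "\<bar>\<dots>\<bar> = (\<beta> * \<alpha>) * \<bar>D - D'\<bar> / (\<bar>E\<bar> * \<bar>E'\<bar>)"
    using ab by (simp add: diff abs_mult abs_divide)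
  also have "\<dots> \<le> 1 * \<bar>D - D'\<bar> / (28 * 28)"
    using ab E by (intro frac_le mult_right_mono mult_le_one mult_mono) auto
  also have "\<dots> \<le> \<bar>D - D'\<bar> / 4" by simp
  finally show ?thesis .
qed

lemma chord_recursion:
  assumes xy: "\<bar>x\<bar> \<le> 1 / 8" "\<bar>y\<bar> \<le> 1 / 8" "x \<noteq> y"
  shows "backstep c x \<noteq> backstep c y"
    and "chord c x y = chord_step c (chord c (backstep c x) (backstep c y)) x y"
proof -
  define \<alpha> \<beta> s where "\<alpha> = drift_inv_slope c (backstep c x) (backstep c y)"
    and "\<beta> = drift_inv_slope c x y" and "s = sin2_dd (backstep c x) (backstep c y)"
  define F D where "F = backstep c x - backstep c y" and "D = chord c (backstep c x) (backstep c y)"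
  \<comment> \<open>also true when the images coincide, as division by 0 gives 0 and both sides vanish\<close>
  have FF: "backstep c (backstep c x) - backstep c (backstep c y) = D * F"
    by (simp add: D_def F_def chord_def)
  have "(drift_inv (backstep c x - backstep c (backstep c x)) - drift_inv (backstep c y - backstep c (backstep c y)))
      - (drift_inv (x - backstep c x) - drift_inv (y - backstep c y))
      = 16 * c * (sin (2 * backstep c x) - sin (2 * backstep c y))"
    using backstep_eq[OF c xy(1)] backstep_eq[OF c xy(2)] by (simp add: right_diff_distrib)
  then have "\<alpha> * ((backstep c x - backstep c (backstep c x)) - (backstep c y - backstep c (backstep c y)))
      - \<beta> * ((x - backstep c x) - (y - backstep c y)) = 16 * c * (s * F)"
    unfolding drift_inv_dd_mult sin2_dd_mult
    by (simp add: \<alpha>_def \<beta>_def s_def F_def drift_inv_slope_def)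
  moreover have "(backstep c x - backstep c (backstep c x)) - (backstep c y - backstep c (backstep c y)) = F - D * F"
    using FF by (simp add: F_def)
  moreover have "(x - backstep c x) - (y - backstep c y) = (x - y) - F" by (simp add: F_def)
  ultimately have "\<alpha> * (F - D * F) - \<beta> * ((x - y) - F) = 16 * c * (s * F)" by simp
  then have rel: "F * chord_denom c D x y = \<beta> * (x - y)"
    unfolding chord_denom_def \<alpha>_def[symmetric] \<beta>_def[symmetric] s_def[symmetric]
    by (simp add: algebra_simps)
  \<comment> \<open>\<open>\<beta> > 0\<close>, so the two images are distinct and the denominator does not vanish\<close>
  have "\<beta> * (x - y) \<noteq> 0" using drift_inv_slope_bounds[OF xy(1,2)] xy(3) by (simp add: \<beta>_def)
  then have nz: "F \<noteq> 0" "chord_denom c D x y \<noteq> 0" using rel by auto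
  show "backstep c x \<noteq> backstep c y" using nz(1) by (simp add: F_def)
  show "chord c x y = chord_step c (chord c (backstep c x) (backstep c y)) x y"
  proof -
    have "F / (x - y) = \<beta> / chord_denom c D x y"
      using rel nz(2) xy(3) by (simp add: frac_eq_eq)
    then show ?thesis
      by (simp add: chord_step_def chord_def[of c x y] F_def D_def \<beta>_def)
  qed
qed

lemma abs_chord:
  assumes "\<bar>x\<bar> \<le> 1 / 8" "\<bar>y\<bar> \<le> 1 / 8"
  shows "\<bar>chord c x y\<bar> \<le> 1 / 4"
proof (cases "x = y")
  case False
  then show ?thesis
    using backstep_contract[OF c assms] by (simp add: chord_def abs_divide field_simps)
qed (simp add: chord_def)

lemma abs_chord_approx:
  assumes "\<bar>x\<bar> \<le> 1 / 8" "\<bar>y\<bar> \<le> 1 / 8"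
  shows "\<bar>chord_approx c n x y\<bar> \<le> 1 / 4"
  using assms
proof (induction n arbitrary: x y)
  case (Suc n)
  then show ?case unfolding chord_approx.simps by (intro abs_chord_step Suc.IH abs_backstep_le c)
qed simp

lemma chord_approx_error:
  assumes "\<bar>x\<bar> \<le> 1 / 8" "\<bar>y\<bar> \<le> 1 / 8" "x \<noteq> y"
  shows "\<bar>chord_approx c n x y - chord c x y\<bar> \<le> (1 / 4) ^ n"
  using assms
proof (induction n arbitrary: x y)
  case 0
  then show ?case using abs_chord[of x y] by simp
next
  case (Suc n)
  have b: "\<bar>backstep c x\<bar> \<le> 1 / 8" "\<bar>backstep c y\<bar> \<le> 1 / 8" using abs_backstep_le[OF c] Suc.prems by auto
  have "\<bar>chord_approx c (Suc n) x y - chord c x y\<bar>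
      \<le> \<bar>chord_approx c n (backstep c x) (backstep c y) - chord c (backstep c x) (backstep c y)\<bar> / 4"
    unfolding chord_recursion(2)[OF Suc.prems] chord_approx.simps
    by (intro chord_step_contract Suc.prems abs_chord_approx abs_chord b)
  also have "\<dots> \<le> (1 / 4) ^ n / 4"
    using Suc.IH[OF b chord_recursion(1)[OF Suc.prems]] by simp
  finally show ?case by simp
qed

lemma chord_approx_cauchy:
  assumes "\<bar>x\<bar> \<le> 1 / 8" "\<bar>y\<bar> \<le> 1 / 8"
  shows "\<bar>chord_approx c (n + m) x y - chord_approx c n x y\<bar> \<le> (1 / 4) ^ n"
  using assms
proof (induction n arbitrary: x y)
  case 0
  then show ?case using abs_chord_approx[of x y m] by simp
next
  case (Suc n)
  have b: "\<bar>backstep c x\<bar> \<le> 1 / 8" "\<bar>backstep c y\<bar> \<le> 1 / 8" using abs_backstep_le[OF c] Suc.prems by auto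
  have "\<bar>chord_approx c (Suc n + m) x y - chord_approx c (Suc n) x y\<bar>
      \<le> \<bar>chord_approx c (n + m) (backstep c x) (backstep c y) - chord_approx c n (backstep c x) (backstep c y)\<bar> / 4"
    unfolding add_Suc chord_approx.simps
    by (intro chord_step_contract Suc.prems abs_chord_approx b)
  also have "\<dots> \<le> (1 / 4) ^ n / 4" using Suc.IH[OF b] by simp
  finally show ?case by simp
qed

abbreviation "sq \<equiv> {-1/8..1/8 :: real} \<times> {-1/8..1/8 :: real}"

text \<open>
  Joint continuity on the square, across the diagonal, is where the extended divided differences pay off.
\<close>

lemma continuous_on_chord_approx: "continuous_on sq (\<lambda>(x, y). chord_approx c n x y)"
proof (induction n)
  case 0
  show ?case by (simp add: case_prod_beta)
next
  case (Suc n)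
  have sq: "\<bar>fst z\<bar> \<le> 1 / 8 \<and> \<bar>snd z\<bar> \<le> 1 / 8" if "z \<in> sq" for z using that by auto
  have b: "continuous_on sq (\<lambda>z. backstep c (fst z))" "continuous_on sq (\<lambda>z. backstep c (snd z))"
    by (auto intro!: continuous_on_compose2[OF continuous_on_backstep[OF c]] continuous_intros)
  have bb: "continuous_on sq (\<lambda>z. (backstep c (fst z), backstep c (snd z)))"
    by (intro continuous_intros b)
  have im: "(\<lambda>z. (backstep c (fst z), backstep c (snd z))) ` sq \<subseteq> sq"
  proof
    fix w assume "w \<in> (\<lambda>z. (backstep c (fst z), backstep c (snd z))) ` sq"
    then obtain z where z: "w = (backstep c (fst z), backstep c (snd z))" "z \<in> sq" by blast
    then have "\<bar>backstep c (fst z)\<bar> \<le> 1 / 8" "\<bar>backstep c (snd z)\<bar> \<le> 1 / 8"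
      using abs_backstep_le[OF c] sq by blast+
    then show "w \<in> sq" using z(1) by auto
  qed
  have slope: "continuous_on sq (\<lambda>z. drift_inv_slope c (fst z) (snd z))"
  proof -
    have dd: "continuous_on ({-1..1} \<times> {-1..1}) (\<lambda>(s, t). drift_inv_dd s t)"
      unfolding drift_inv_dd_def
      by (intro continuous_on_divdiff drift_inv_has_derivative continuous_on_drift_inv' abs_less_drift_range)
    have "continuous_on sq (\<lambda>z. (fst z - backstep c (fst z), snd z - backstep c (snd z)))"
      by (intro continuous_intros b)
    from continuous_on_compose2[OF dd this]
    show ?thesis using backstep_diff_range sq by (fastforce simp: drift_inv_slope_def case_prod_beta)
  qed
  have slope': "continuous_on sq (\<lambda>z. drift_inv_slope c (backstep c (fst z)) (backstep c (snd z)))"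
    using continuous_on_compose2[OF slope bb im] by simp
  have "continuous_on sq (\<lambda>(s, t). sin2_dd s t)"
    unfolding sin2_dd_def
    by (intro continuous_on_divdiff sin2_has_derivative continuous_intros)
  from continuous_on_compose2[OF this bb im]
  have sin2: "continuous_on sq (\<lambda>z. sin2_dd (backstep c (fst z)) (backstep c (snd z)))" by simp
  have prev: "continuous_on sq (\<lambda>z. chord_approx c n (backstep c (fst z)) (backstep c (snd z)))"
    using continuous_on_compose2[OF Suc bb im] by simp
  have nz: "chord_denom c (chord_approx c n (backstep c (fst z)) (backstep c (snd z))) (fst z) (snd z) \<noteq> 0"
    if "z \<in> sq" for z
  proof -
    have z: "\<bar>fst z\<bar> \<le> 1 / 8" "\<bar>snd z\<bar> \<le> 1 / 8" using sq[OF that] by auto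
    have "\<bar>chord_approx c n (backstep c (fst z)) (backstep c (snd z))\<bar> \<le> 1 / 4"
      by (intro abs_chord_approx abs_backstep_le c z)
    from chord_denom_bound[OF z this] show ?thesis by auto
  qed
  have denom: "continuous_on sq (\<lambda>z. chord_denom c
      (chord_approx c n (backstep c (fst z)) (backstep c (snd z))) (fst z) (snd z))"
    unfolding chord_denom_def by (intro continuous_intros slope slope' sin2 prev)
  show ?case
    unfolding chord_approx.simps chord_step_def case_prod_beta
    by (intro continuous_on_divide slope denom) (use nz in blast)
qed

text \<open>
  The approximations to the chord slope are continuous on the whole square and converge uniformly, so
  their limit is continuous, and off the diagonal it is the chord slope. Thus the chord slope extends
  continuously to the diagonal, which says that \<^const>\<open>backstep\<close> is continuously differentiable. The
  invariance equation thus yields smoothness without any estimate of second derivatives.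
\<close>

lemma backstep_continuously_differentiable:
  obtains f' where "continuous_on {-1/8..1/8} f'"
    and "\<And>x. \<bar>x\<bar> < 1 / 8 \<Longrightarrow> (backstep c has_real_derivative f' x) (at x)"
    and "\<And>x. \<bar>x\<bar> < 1 / 8 \<Longrightarrow> \<bar>f' x\<bar> \<le> 1 / 4"
proof -
  have "uniformly_convergent_on sq (\<lambda>n (x, y). chord_approx c n x y)"
  proof (intro Cauchy_uniformly_convergent uniformly_Cauchy_onI')
    fix e :: real assume "e > 0"
    then obtain M where M: "(1 / 4) ^ M < e" using real_arch_pow_inv[of e "1/4"] by auto
    have "dist (chord_approx c m x y) (chord_approx c n x y) < e"
      if "m \<ge> M" "n > m" "\<bar>x\<bar> \<le> 1 / 8" "\<bar>y\<bar> \<le> 1 / 8" for m n x y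
    proof -
      have "\<bar>chord_approx c n x y - chord_approx c m x y\<bar> \<le> (1 / 4) ^ m"
        using chord_approx_cauchy[of x y m "n - m"] that by simp
      also have "\<dots> \<le> (1 / 4) ^ M" using that by (intro power_decreasing) auto
      finally show ?thesis using M by (simp add: dist_real_def abs_minus_commute)
    qed
    then show "\<exists>M. \<forall>z\<in>sq. \<forall>m\<ge>M. \<forall>n>m.
        dist (case z of (x, y) \<Rightarrow> chord_approx c m x y) (case z of (x, y) \<Rightarrow> chord_approx c n x y) < e"
      by (intro exI[of _ M]) (auto simp: abs_le_iff)
  qed
  then obtain q where q: "uniform_limit sq (\<lambda>n (x, y). chord_approx c n x y) q sequentially"
    unfolding uniformly_convergent_on_def by blast
  have q_cont: "continuous_on sq q"
    by (rule uniform_limit_theorem[OF _ q]) (intro always_eventually allI continuous_on_chord_approx, simp)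
  have q_lim: "(\<lambda>n. chord_approx c n x y) \<longlonglongrightarrow> q (x, y)" if "\<bar>x\<bar> \<le> 1 / 8" "\<bar>y\<bar> \<le> 1 / 8" for x y
  proof -
    have "x \<in> {-1/8..1/8}" "y \<in> {-1/8..1/8}" using that by auto
    then have "(x, y) \<in> sq" by simp
    from tendsto_uniform_limitI[OF q this] show ?thesis by simp
  qed
  have q_chord: "q (x, y) = chord c x y" if "\<bar>x\<bar> \<le> 1 / 8" "\<bar>y\<bar> \<le> 1 / 8" "x \<noteq> y" for x y
  proof (rule LIMSEQ_unique[OF q_lim[OF that(1,2)]])
    have "(\<lambda>n. chord_approx c n x y - chord c x y) \<longlonglongrightarrow> 0"
      by (rule Lim_null_comparison[OF always_eventually LIMSEQ_power_zero[of "1/4 :: real"]])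
         (use chord_approx_error[OF that] in auto)
    then show "(\<lambda>n. chord_approx c n x y) \<longlonglongrightarrow> chord c x y" by (simp add: LIM_zero_iff)
  qed
  show ?thesis
  proof
    show "continuous_on {-1/8..1/8} (\<lambda>x. q (x, x))"
      by (rule continuous_on_compose2[OF q_cont]) (auto intro!: continuous_intros)
    fix x :: real assume x: "\<bar>x\<bar> < 1 / 8"
    show "\<bar>q (x, x)\<bar> \<le> 1 / 4"
      by (rule LIMSEQ_le_const2[OF tendsto_rabs[OF q_lim]]) (use x abs_chord_approx in auto)
    have "continuous_on {-1/8..1/8} (\<lambda>y. q (y, x))"
      by (rule continuous_on_compose2[OF q_cont]) (use x in \<open>auto intro!: continuous_intros\<close>)
    then have "continuous (at x) (\<lambda>y. q (y, x))"
      using x by (intro continuous_on_interior[of "{-1/8..1/8}"]) (auto simp: abs_less_iff)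
    then have "(\<lambda>y. q (y, x)) \<midarrow>x\<rightarrow> q (x, x)" by (simp add: continuous_at)
    moreover have "\<forall>\<^sub>F y in at x. q (y, x) = (backstep c y - backstep c x) / (y - x)"
    proof -
      have "\<forall>\<^sub>F y in at x. y \<in> {-1/8<..<1/8} \<and> y \<noteq> x"
        using x by (intro eventually_conj eventually_at_in_open' eventually_neq_at_within) auto
      then show ?thesis
        by eventually_elim (use x q_chord in \<open>auto simp: chord_def\<close>)
    qed
    ultimately show "(backstep c has_real_derivative q (x, x)) (at x)"
      unfolding has_field_derivative_iff by (rule Lim_transform_eventually)
  qed
qed

end

section \<open>The local unstable curve of a saddle\<close>

text \<open>
  Along a backward orbit the momentum is a function of consecutive angles, so a neighbourhood of the
  saddle that constrains the angle alone suffices.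
\<close>

definition strip :: "real \<Rightarrow> cyl set" where
  "strip a = cyl_of ` ({a - 1/8<..<a + 1/8} \<times> UNIV)"

lemma open_strip: "open (strip a)"
  unfolding strip_def by (intro open_cyl_of_image open_Times) auto

lemma cyl_of_near_inj:
  assumes "cyl_of (a + x, p) = cyl_of (a + y, r)" "\<bar>x\<bar> < 1 / 8" "\<bar>y\<bar> < 1 / 8"
  shows "x = y" "p = r"
proof -
  obtain k :: int where k: "x = y + of_int k * pi"
    using assms(1) by (auto simp: cyl_of_def circ_of_eq_iff algebra_simps)
  have "k = 0"
  proof (rule ccontr)
    assume "k \<noteq> 0"
    then have "1 \<le> \<bar>real_of_int k\<bar>" by linarith
    then have "1 * pi \<le> \<bar>real_of_int k\<bar> * pi" by (intro mult_right_mono) auto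
    also have "\<dots> = \<bar>x - y\<bar>" using k by (simp add: abs_mult)
    finally show False using assms(2,3) pi_gt3 by linarith
  qed
  then show "x = y" using k by simp
  show "p = r" using assms(1) by (simp add: cyl_of_def)
qed

lemma sin_double_shift: "sin (2 * a) = 0 \<Longrightarrow> sin (2 * (a + x)) = cos (2 * a) * sin (2 * x)" for a x :: real
  by (simp add: distrib_left sin_add)

context
  fixes a c :: real
  assumes a: "sin (2 * a) = 0" and c_def: "c = cos (2 * a)"
begin

lemma abs_c: "\<bar>c\<bar> = 1"
  using sin_cos_squared_add[of "2 * a"] a by (simp add: c_def abs_square_eq_1)

definition graph_point :: "real \<Rightarrow> real \<times> real" where
  "graph_point x = (a + x, drift_inv (x - backstep c x))"

lemma local_seq_backward_orbit:
  assumes v: "local_seq c v"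
  defines "w \<equiv> \<lambda>k. cyl_of (a + v k, drift_inv (v k - v (Suc k)))"
  shows "w (Suc k) \<in> domF" "F0 (w (Suc k)) = w k" "w \<longlonglongrightarrow> cyl_of (a, 0)"
proof -
  have range: "\<bar>v k - v (Suc k)\<bar> < 2 * pi / 3" for k
    using local_seq_bound[OF v, of k] local_seq_bound[OF v, of "Suc k"] pi_gt3 by linarith
  have kick: "drift_inv (v (Suc k) - v (Suc (Suc k))) - 16 * sin (2 * (a + v (Suc k)))
      = drift_inv (v k - v (Suc k))"
  proof -
    have "drift_inv (v (Suc k) - v (Suc (Suc k))) - drift_inv (v k - v (Suc k))
        = 16 * c * sin (2 * v (Suc k))"
      using v unfolding local_seq_def by blast
    then show ?thesis unfolding sin_double_shift[OF a] c_def[symmetric] by linarith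
  qed
  show "w (Suc k) \<in> domF"
    unfolding w_def domF_cyl_of using kick drift_inv_bound[OF range] by simp
  show "F0 (w (Suc k)) = w k"
    unfolding w_def F0_cyl_of F0_lift_def Let_def using kick drift_drift_inv[OF range] by simp
  have v0: "v \<longlonglongrightarrow> 0" by (rule local_seq_tendsto_0[OF abs_c v])
  have "(\<lambda>k. v k - v (Suc k)) \<longlonglongrightarrow> 0 - 0" by (intro tendsto_diff v0 LIMSEQ_Suc)
  then have "(\<lambda>k. drift_inv (v k - v (Suc k))) \<longlonglongrightarrow> drift_inv (0 - 0)"
    by (rule continuous_on_tendsto_compose[OF continuous_on_drift_inv[of UNIV]]) auto
  then have "(\<lambda>k. (a + v k, drift_inv (v k - v (Suc k)))) \<longlonglongrightarrow> (a + 0, 0)"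
    by (intro tendsto_Pair tendsto_add tendsto_const v0) simp
  then show "w \<longlonglongrightarrow> cyl_of (a, 0)"
    unfolding w_def using continuous_on_tendsto_compose[OF continuous_on_cyl_of[of UNIV]] by fastforce
qed

text \<open>
  A backward orbit in the strip has lifted angles \<open>a + x n\<close> with \<open>\<bar>x n\<bar> < 1/8\<close>. Since \<open>\<bar>drift\<bar> < 2\<pi>/3\<close>, the difference
  of consecutive lifts is off from the drift by less than \<open>\<pi>\<close>, so the congruence modulo \<open>\<pi>\<close> is an
  equation and the recurrence holds for \<open>x\<close>. Conversely every solution of the recurrence tends to 0.
  So the local unstable set is the graph over the full interval.
\<close>

lemma Wu_part_strip:
  "Wu_part (cyl_of (a, 0)) (strip a) 0 = (\<lambda>x. cyl_of (graph_point x)) ` {-1/8<..<1/8}"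
proof (intro set_eqI iffI)
  fix z assume "z \<in> (\<lambda>x. cyl_of (graph_point x)) ` {-1/8<..<1/8}"
  then obtain x where x: "z = cyl_of (graph_point x)" "\<bar>x\<bar> < 1 / 8" by auto
  define v where "v k = (backstep c ^^ k) x" for k
  have v: "local_seq c v" unfolding v_def using local_seq_iterate_backstep[OF abs_c] x(2) by simp
  define w where "w k = cyl_of (a + v k, drift_inv (v k - v (Suc k)))" for k
  have vb: "\<bar>v k\<bar> < 1 / 8" for k
  proof (induction k)
    case (Suc k)
    have "\<bar>v (Suc k)\<bar> \<le> \<bar>v k\<bar> / 4"
      using abs_backstep[OF abs_c local_seq_bound[OF v]] by (simp add: v_def)
    then show ?case using Suc by linarith
  qed (use x(2) in \<open>simp add: v_def\<close>)
  have "w 0 = z" by (simp add: w_def x(1) v_def graph_point_def)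
  moreover have "w k \<in> strip a" for k
    using vb[of k] unfolding w_def strip_def by (intro imageI) auto
  moreover have "w (Suc k) \<in> domF" "F0 (w (Suc k)) = w k" "w \<longlonglongrightarrow> cyl_of (a, 0)" for k
    unfolding w_def[abs_def] by (rule local_seq_backward_orbit[OF v])+
  ultimately show "z \<in> Wu_part (cyl_of (a, 0)) (strip a) 0"
    unfolding Wu_part_def backward_orbit_def by blast
next
  fix z assume "z \<in> Wu_part (cyl_of (a, 0)) (strip a) 0"
  then obtain w where w: "w 0 = z" "\<And>n. w (Suc n) \<in> domF" "\<And>n. F0 (w (Suc n)) = w n"
      "\<And>n. w n \<in> strip a"
    by (auto simp: Wu_part_def backward_orbit_def)
  have "\<exists>x p. w n = cyl_of (a + x, p) \<and> \<bar>x\<bar> < 1 / 8" for n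
  proof -
    obtain t p where "w n = cyl_of (t, p)" "t \<in> {a - 1/8<..<a + 1/8}"
      using w(4)[of n] by (auto simp: strip_def)
    moreover from this have "\<bar>t - a\<bar> < 1 / 8" unfolding greaterThanLessThan_iff by linarith
    ultimately have "w n = cyl_of (a + (t - a), p) \<and> \<bar>t - a\<bar> < 1 / 8" by simp
    then show ?thesis by blast
  qed
  then obtain x p where xp: "\<And>n. w n = cyl_of (a + x n, p n)" "\<And>n. \<bar>x n\<bar> < 1 / 8" by metis
  have kick: "p (Suc n) - 16 * sin (2 * (a + x (Suc n))) = p n" for n
    using arg_cong[OF w(3)[of n], of snd] by (simp add: xp F0_cyl_of F0_lift_def Let_def)
  have p1: "\<bar>p n\<bar> < 1" for n
    using w(2)[of n] kick[of n] by (simp add: xp(1) domF_cyl_of)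
  have diff: "x n - x (Suc n) = drift (p n)" for n
  proof -
    have "circ_of (a + x (Suc n) + drift (p n)) = circ_of (a + x n)"
      using arg_cong[OF w(3)[of n], of fst] kick[of n] by (simp add: xp F0_cyl_of F0_lift_def Let_def)
    then obtain k :: int where k: "x (Suc n) + drift (p n) = x n + of_int k * pi"
      unfolding circ_of_eq_iff by auto
    have "k = 0"
    proof (rule ccontr)
      assume "k \<noteq> 0"
      then have "1 \<le> \<bar>real_of_int k\<bar>" by linarith
      then have "1 * pi \<le> \<bar>real_of_int k\<bar> * pi" by (intro mult_right_mono) auto
      then have "pi \<le> \<bar>real_of_int k * pi\<bar>" by (simp add: abs_mult)
      moreover have "real_of_int k * pi = x (Suc n) - x n + drift (p n)" using k by linarith
      ultimately show False
        using abs_drift_less[OF p1[of n]] xp(2)[of n] xp(2)[of "Suc n"] pi_gt3 by linarith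
    qed
    then show ?thesis using k by simp
  qed
  have p: "p n = drift_inv (x n - x (Suc n))" for n
    using diff drift_inv_drift[OF p1] by simp
  have "local_seq c x"
    unfolding local_seq_def
  proof (intro conjI allI)
    show "\<bar>x k\<bar> \<le> 1 / 8" for k using xp(2)[of k] by simp
    show "drift_inv (x (Suc k) - x (Suc (Suc k))) - drift_inv (x k - x (Suc k))
        = 16 * c * sin (2 * x (Suc k))" for k
      using kick[of k] sin_double_shift[OF a, of "x (Suc k)"] unfolding p[symmetric] c_def
      by (simp add: algebra_simps)
  qed
  from local_seq_backstep[OF abs_c this, of 0]
  have "z = cyl_of (graph_point (x 0))" using w(1) xp(1)[of 0] p[of 0] by (simp add: graph_point_def)
  moreover have "x 0 \<in> {-1/8<..<1/8}" using xp(2)[of 0] by auto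
  ultimately show "z \<in> (\<lambda>x. cyl_of (graph_point x)) ` {-1/8<..<1/8}" by blast
qed

text \<open>
  The angle coordinate near the saddle, recovered from a continuous function on the circle. It provides
  the continuous inverse of the parametrization.
\<close>

lemma graph_point_section:
  assumes "\<bar>x\<bar> \<le> 1 / 8" shows "arcsin (c * circ_sin2 (fst (cyl_of (graph_point x)))) / 2 = x"
proof -
  have "c * c = 1" using abs_c by (metis abs_mult_self_eq mult_1)
  moreover have "circ_sin2 (fst (cyl_of (graph_point x))) = c * sin (2 * x)"
    unfolding graph_point_def fst_cyl_of circ_sin2_circ_of fst_conv sin_double_shift[OF a]
      c_def[symmetric] ..
  ultimately have "c * circ_sin2 (fst (cyl_of (graph_point x))) = sin (2 * x)"
    by (simp add: mult.assoc[symmetric])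
  moreover have "arcsin (sin (2 * x)) = 2 * x"
    using assms pi_gt3 by (intro arcsin_sin) auto
  ultimately show ?thesis by simp
qed

lemma local_unstable_curve:
  assumes x: "\<bar>x\<bar> < 1 / 8"
  shows "\<exists>L\<subseteq>unstable_cone.
    embedded_curve_tangent (Wu_part (cyl_of (a, 0)) (strip a) 0) (cyl_of (graph_point x)) L"
proof -
  obtain f' where f': "continuous_on {-1/8..1/8} f'"
    "\<And>x. \<bar>x\<bar> < 1 / 8 \<Longrightarrow> (backstep c has_real_derivative f' x) (at x)"
    "\<And>x. \<bar>x\<bar> < 1 / 8 \<Longrightarrow> \<bar>f' x\<bar> \<le> 1 / 4"
    using backstep_continuously_differentiable[OF abs_c] by metis
  \<comment> \<open>the largest radius with \<open>x \<plusminus> \<rho>\<close> still in the interval of the graph\<close>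
  define \<rho> where "\<rho> = 1 / 8 - \<bar>x\<bar>"
  have \<rho>: "\<rho> > 0" using x by (simp add: \<rho>_def)
  let ?I = "{-1<..<1::real}"
  have sm: "\<bar>x + \<rho> * t\<bar> < 1 / 8" if "t \<in> ?I" for t
  proof -
    have "\<bar>\<rho> * t\<bar> < \<rho>" using that \<rho> by (auto simp: abs_mult abs_less_iff)
    then show ?thesis using abs_triangle_ineq[of x "\<rho> * t"] unfolding \<rho>_def by linarith
  qed
  have sm': "x + \<rho> * t \<in> {-1/8<..<1/8}" if "t \<in> ?I" for t
    using sm[OF that] unfolding greaterThanLessThan_iff by (intro conjI; linarith)
  define V where "V = cyl_of ` ({a + x - \<rho><..<a + x + \<rho>} \<times> (UNIV :: real set))"
  define \<gamma> where "\<gamma> t = graph_point (x + \<rho> * t)" for t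
  define slope where "slope y = drift_inv' (y - backstep c y) * (1 - f' y)" for y
  define \<gamma>' where "\<gamma>' t = \<rho> *\<^sub>R (1 :: real, slope (x + \<rho> * t))" for t
  have diff_small: "y - backstep c y \<in> {-1..1}" if "\<bar>y\<bar> < 1 / 8" for y
    using that backstep_diff_range[OF abs_c, of y] by simp
  have gder: "(graph_point has_vector_derivative (1, slope y)) (at y)" if y: "\<bar>y\<bar> < 1 / 8" for y
  proof -
    have "((\<lambda>y. y - backstep c y) has_real_derivative (1 - f' y)) (at y)"
      by (intro DERIV_diff DERIV_ident f'(2) y)
    from DERIV_chain2[OF drift_inv_has_derivative this] diff_small[OF y]
    have "((\<lambda>y. drift_inv (y - backstep c y)) has_real_derivative slope y) (at y)"
      unfolding slope_def using abs_less_drift_range by blast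
    then have "((\<lambda>y. (a + y, drift_inv (y - backstep c y))) has_vector_derivative (1, slope y)) (at y)"
      by (intro has_vector_derivative_Pair)
         (auto intro!: derivative_eq_intros simp: has_real_derivative_iff_has_vector_derivative)
    then show ?thesis by (simp add: graph_point_def[abs_def])
  qed
  have \<gamma>_der: "(\<gamma> has_vector_derivative \<gamma>' t) (at t)" if t: "t \<in> ?I" for t
  proof -
    have "((\<lambda>t. x + \<rho> * t) has_vector_derivative \<rho>) (at t)"
      by (auto intro!: derivative_eq_intros simp: has_real_derivative_iff_has_vector_derivative[symmetric])
    from vector_diff_chain_at[OF this gder[OF sm[OF t]]]
    show ?thesis unfolding \<gamma>_def[abs_def] \<gamma>'_def o_def .
  qed
  have \<gamma>'_nz: "\<gamma>' t \<noteq> 0" for t using \<rho> by (simp add: \<gamma>'_def zero_prod_def)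
  have slope_cont: "continuous_on {-1/8<..<1/8} slope"
  proof -
    have sub: "{-1/8<..<1/8} \<subseteq> {-1/8..1/8 :: real}" by auto
    have b: "continuous_on {-1/8<..<1/8} (\<lambda>y. y - backstep c y)"
      by (intro continuous_intros continuous_on_subset[OF continuous_on_backstep[OF abs_c] sub])
    have "(\<lambda>y. y - backstep c y) ` {-1/8<..<1/8} \<subseteq> {-1..1}"
      using diff_small by (auto simp: abs_less_iff)
    from continuous_on_compose2[OF continuous_on_drift_inv' b this]
    show ?thesis
      unfolding slope_def[abs_def] by (intro continuous_intros continuous_on_subset[OF f'(1) sub])
  qed
  have \<gamma>'_cont: "continuous_on ?I \<gamma>'"
    unfolding \<gamma>'_def[abs_def]
    by (intro continuous_intros continuous_on_compose2[OF slope_cont])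
       (use sm' in blast)+
  have SV: "Wu_part (cyl_of (a, 0)) (strip a) 0 \<inter> V = (\<lambda>t. cyl_of (\<gamma> t)) ` ?I"
  proof (intro set_eqI iffI)
    fix z assume "z \<in> Wu_part (cyl_of (a, 0)) (strip a) 0 \<inter> V"
    then obtain y s p where "z = cyl_of (graph_point y)" "y \<in> {-1/8<..<1/8}"
      and "z = cyl_of (s, p)" "s \<in> {a + x - \<rho><..<a + x + \<rho>}"
      unfolding Wu_part_strip V_def by blast
    then have y: "z = cyl_of (graph_point y)" "\<bar>y\<bar> < 1 / 8"
      and s: "z = cyl_of (s, p)" "\<bar>s - (a + x)\<bar> < \<rho>"
      by (auto simp: abs_less_iff)
    have "cyl_of (a + y, drift_inv (y - backstep c y)) = cyl_of (a + (s - a), p)"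
      using y(1) s(1) by (simp add: graph_point_def)
    moreover have "\<bar>s - a\<bar> < 1 / 8" using s(2) unfolding \<rho>_def by linarith
    ultimately have "y = s - a" using cyl_of_near_inj(1) y(2) by blast
    then have "\<bar>y - x\<bar> < \<rho>" using s(2) by (simp add: algebra_simps)
    then have "(y - x) / \<rho> \<in> ?I" using \<rho> by (auto simp: abs_less_iff field_simps)
    moreover have "z = cyl_of (\<gamma> ((y - x) / \<rho>))" using y(1) \<rho> by (simp add: \<gamma>_def)
    ultimately show "z \<in> (\<lambda>t. cyl_of (\<gamma> t)) ` ?I" by blast
  next
    fix z assume "z \<in> (\<lambda>t. cyl_of (\<gamma> t)) ` ?I"
    then obtain t where t: "z = cyl_of (\<gamma> t)" "t \<in> ?I" by blast
    have "\<bar>\<rho> * t\<bar> < \<rho>" using t(2) \<rho> by (auto simp: abs_mult abs_less_iff)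
    then have "z \<in> V" unfolding t(1) V_def \<gamma>_def graph_point_def by (intro imageI) (auto simp: abs_less_iff)
    moreover have "z \<in> Wu_part (cyl_of (a, 0)) (strip a) 0"
      unfolding Wu_part_strip t(1) \<gamma>_def using sm'[OF t(2)] by blast
    ultimately show "z \<in> Wu_part (cyl_of (a, 0)) (strip a) 0 \<inter> V" by blast
  qed
  define h where "h z = (arcsin (c * circ_sin2 (fst z)) / 2 - x) / \<rho>" for z :: cyl
  have h\<gamma>: "h (cyl_of (\<gamma> t)) = t" if "t \<in> ?I" for t
    unfolding h_def \<gamma>_def graph_point_section[OF less_imp_le[OF sm[OF that]]] using \<rho> by simp
  have "homeomorphism ?I (Wu_part (cyl_of (a, 0)) (strip a) 0 \<inter> V) (\<lambda>t. cyl_of (\<gamma> t)) h"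
    unfolding SV
  proof (rule homeomorphismI)
    have "continuous_on ?I \<gamma>"
      using \<gamma>_der by (meson continuous_at_imp_continuous_on has_vector_derivative_continuous)
    then show "continuous_on ?I (\<lambda>t. cyl_of (\<gamma> t))"
      by (rule continuous_on_compose2[OF continuous_on_cyl_of[of UNIV]]) auto
    have "continuous_on UNIV (\<lambda>z :: cyl. circ_sin2 (fst z))"
      by (rule continuous_on_compose2[OF continuous_on_circ_sin2[of UNIV]]) (auto intro!: continuous_intros)
    moreover have "-1 \<le> circ_sin2 (fst z) \<and> circ_sin2 (fst z) \<le> 1" for z :: cyl
    proof -
      obtain q where "z = cyl_of q" by (rule cyl_cases)
      then show ?thesis by simp
    qed
    then have "\<bar>c * circ_sin2 (fst z)\<bar> \<le> 1" for z :: cyl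
      using abs_c by (simp add: abs_mult abs_le_iff)
    then have "-1 \<le> c * circ_sin2 (fst z) \<and> c * circ_sin2 (fst z) \<le> 1" for z :: cyl
      by (simp only: abs_le_iff) (metis minus_le_iff)
    ultimately have "continuous_on UNIV h"
      unfolding h_def[abs_def] using \<rho> by (intro continuous_intros) auto
    then show "continuous_on ((\<lambda>t. cyl_of (\<gamma> t)) ` ?I) h" by (rule continuous_on_subset) simp
  qed (use h\<gamma> in auto)
  moreover have "cyl_of (\<gamma> 0) = cyl_of (graph_point x)" by (simp add: \<gamma>_def)
  moreover have "open V" unfolding V_def by (intro open_cyl_of_image open_Times) auto
  moreover have "cyl_of (graph_point x) \<in> V"
    unfolding V_def graph_point_def using \<rho> by (intro imageI) auto
  ultimately have "embedded_curve_tangent (Wu_part (cyl_of (a, 0)) (strip a) 0)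
      (cyl_of (graph_point x)) (span {\<gamma>' 0})"
    unfolding embedded_curve_tangent_def using \<gamma>_der \<gamma>'_nz \<gamma>'_cont
    by (intro exI[of _ V] exI[of _ \<gamma>] exI[of _ \<gamma>'] exI[of _ h]) auto
  moreover have "span {\<gamma>' 0} \<subseteq> unstable_cone"
  proof -
    have r: "\<bar>x - backstep c x\<bar> < 2 * pi / 3" by (intro abs_less_drift_range diff_small x)
    have "\<bar>slope x\<bar> = drift_inv' (x - backstep c x) * \<bar>1 - f' x\<bar>"
      using drift_inv'_bounds[OF r] by (simp add: slope_def abs_mult)
    also have "\<dots> \<le> 1 * 2" using drift_inv'_bounds[OF r] f'(3)[OF x] by (intro mult_mono) auto
    finally have s: "\<bar>slope x\<bar> \<le> 2" by simp
    show ?thesis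
    proof
      fix w assume "w \<in> span {\<gamma>' 0}"
      then obtain k where "w = k *\<^sub>R \<gamma>' 0" by (auto simp: span_singleton)
      then have "w = (k * \<rho>) *\<^sub>R (1, slope x)" by (simp add: \<gamma>'_def)
      then show "w \<in> unstable_cone"
        using mult_left_mono[OF s, of "\<bar>k * \<rho>\<bar>"] by (simp add: unstable_cone_def abs_mult mult.commute)
    qed
  qed
  ultimately show ?thesis by blast
qed

end

section \<open>Invariant curves along the heteroclinic orbit\<close>

text \<open>
  Pushing the local curve forward along the orbit. The set \<^term>\<open>Wu_part A U (Suc N)\<close> is the image of
  the part of \<^term>\<open>Wu_part A U N\<close> in the domain of the map, so each step of the orbit increases \<open>N\<close> by one; the invariance of the cone keeps
  control of the tangent.
\<close>

lemma unstable_curve_along_orbit: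
  fixes z :: "int \<Rightarrow> cyl"
  assumes orbit: "is_orbit z"
    and cone: "\<And>n q. cyl_of q = z n \<Longrightarrow> 24 / 25 \<le> \<bar>cos (2 * fst q)\<bar>"
    and start: "\<And>n. n \<le> m \<Longrightarrow> \<exists>L\<subseteq>unstable_cone. embedded_curve_tangent (Wu_part A U 0) (z n) L"
  shows "\<exists>N. \<exists>L\<subseteq>unstable_cone. embedded_curve_tangent (Wu_part A U N) (z n) L"
proof (cases "n \<le> m")
  case True
  then show ?thesis using start by blast
next
  case False
  then have "m \<le> n" by simp
  then show ?thesis
  proof (induction n rule: int_ge_induct)
    case base
    then show ?case using start by blast
  next
    case (step n)
    then obtain N L where "L \<subseteq> unstable_cone" "embedded_curve_tangent (Wu_part A U N) (z n) L" by blast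
    moreover have "z n \<in> domF" "F0 (z n) = z (n + 1)" using orbit by (auto simp: is_orbit_def)
    ultimately show ?case using unstable_curve_step[of A U N "z n" L] cone by metis
  qed
qed

lemma filterlim_int_minus_at_bot: "filterlim (\<lambda>k. n - int k) at_bot sequentially"
  unfolding filterlim_at_bot eventually_sequentially
proof
  fix Z show "\<exists>N. \<forall>k\<ge>N. n - int k \<le> Z" by (intro exI[of _ "nat (n - Z)"]) auto
qed

lemma filterlim_int_plus_at_top: "filterlim (\<lambda>k. n + int k) at_top sequentially"
  unfolding filterlim_at_top eventually_sequentially
proof
  fix Z show "\<exists>N. \<forall>k\<ge>N. Z \<le> n + int k" by (intro exI[of _ "nat (Z - n)"]) auto
qed

lemma tendsto_at_bot_int:
  fixes f :: "int \<Rightarrow> 'a::topological_space"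
  assumes "(\<lambda>k. f (m - int k)) \<longlonglongrightarrow> l" shows "(f \<longlongrightarrow> l) at_bot"
proof (rule topological_tendstoI)
  fix S assume "open S" "l \<in> S"
  then obtain K where K: "\<And>k. k \<ge> K \<Longrightarrow> f (m - int k) \<in> S"
    using topological_tendstoD[OF assms] unfolding eventually_sequentially by blast
  have "f n \<in> S" if "n \<le> m - int K" for n
    using K[of "nat (m - n)"] that by simp
  then show "\<forall>\<^sub>F n in at_bot. f n \<in> S" unfolding eventually_at_bot_linorder by blast
qed

lemma tendsto_at_top_int:
  fixes f :: "int \<Rightarrow> 'a::topological_space"
  assumes "(\<lambda>k. f (m + int k)) \<longlonglongrightarrow> l" shows "(f \<longlongrightarrow> l) at_top"
proof (rule topological_tendstoI)
  fix S assume "open S" "l \<in> S"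
  then obtain K where K: "\<And>k. k \<ge> K \<Longrightarrow> f (m + int k) \<in> S"
    using topological_tendstoD[OF assms] unfolding eventually_sequentially by blast
  have "f n \<in> S" if "n \<ge> m + int K" for n
    using K[of "nat (n - m)"] that by simp
  then show "\<forall>\<^sub>F n in at_top. f n \<in> S" unfolding eventually_at_top_linorder by blast
qed

theorem proposition4p3:
  fixes u :: "int \<Rightarrow> real" and p :: "int \<Rightarrow> real"
  assumes "u \<in> ball_B" and "T_op u = u"
    and "\<And>n. p n = drift_inv (theta u n - theta u (n - 1))"
  shows "is_orbit (\<lambda>n. cyl_of (theta u n, p n)) \<and>
         transverse_heteroclinic saddle_X saddle_Y (\<lambda>n. cyl_of (theta u n, p n))"
proof -
  define z where "z n = cyl_of (theta u n, p n)" for n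
  note p = assms(3)
  have u_le: "\<bar>u n\<bar> \<le> 1 / 8" for n
  proof -
    obtain B where "\<And>n. \<bar>u n\<bar> \<le> B"
      using assms(1) by (auto simp: ball_B_def bounded_iff)
    then have "bdd_above (range (\<lambda>n. \<bar>u n\<bar>))" by (intro bdd_aboveI[of _ B]) auto
    then have "\<bar>u n\<bar> \<le> (SUP n. \<bar>u n\<bar>)" by (intro cSUP_upper) auto
    then show ?thesis using assms(1) by (simp add: ball_B_def)
  qed
  have step: "\<bar>theta u n - theta u (n - 1)\<bar> < 2 * pi / 3" for n
  proof -
    have "\<bar>s_seq n - s_seq (n - 1)\<bar> \<le> pi / 2" by (simp add: s_seq_def)
    then show ?thesis using u_le[of n] u_le[of "n - 1"] pi_gt3 unfolding theta_def by linarith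
  qed
  have p1: "\<bar>p n\<bar> < 1" for n unfolding p by (rule drift_inv_bound[OF step])
  have sigma: "\<bar>sigma n\<bar> = 1" and sin_s: "sin (2 * s_seq n) = 0" for n
    by (simp_all add: sigma_def s_seq_def)
  have sin_theta: "sin (2 * theta u n) = sigma n * sin (2 * u n)" for n
    using sin_double_shift[OF sin_s, of n "u n"] by (simp add: theta_def sigma_def)
  define Y where "Y n = (p n - p (n + 1)) / 16" for n
  have Y: "\<bar>Y n\<bar> \<le> 1 / 8" for n using p1[of n] p1[of "n + 1"] by (simp add: Y_def)
  have sin_u: "sin (2 * u n) = sigma n * Y n" for n
  proof -
    have "u n = sigma n / 2 * arcsin (Y n)"
      using fun_cong[OF assms(2), of n] p[of n] p[of "n + 1"] by (simp add: T_op_def Y_def)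
    then have "2 * u n = sigma n * arcsin (Y n)" by simp
    moreover have "sigma n = 1 \<or> sigma n = -1" using sigma[of n] by linarith
    then have "sin (sigma n * arcsin (Y n)) = sigma n * sin (arcsin (Y n))" by auto
    ultimately have "sin (2 * u n) = sigma n * sin (arcsin (Y n))" by (simp only:)
    then show ?thesis using Y[of n] by simp
  qed
  \<comment> \<open>the fixed-point equation is the kick equation solved for \<open>u n\<close>\<close>
  have kick: "16 * sin (2 * theta u n) = p n - p (n + 1)" for n
  proof -
    have "sigma n * sigma n = 1" using sigma[of n] by (metis abs_mult_self_eq mult_1)
    then show ?thesis unfolding sin_theta sin_u by (simp add: Y_def mult.assoc[symmetric])
  qed
  \<comment> \<open>the closed bound improves to the open one that the strips need\<close>
  have u_less: "\<bar>u n\<bar> < 1 / 8" for n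
    using sin2_expanding[OF u_le[of n], of 0] Y[of n] sigma[of n] by (simp add: sin_u abs_mult)

  have F0_z: "F0 (z n) = z (n + 1)" for n
    using kick[of n] p[of "n + 1"] drift_drift_inv[OF step[of "n + 1"]]
    by (simp add: z_def F0_cyl_of F0_lift_def)
  have domF_z: "z n \<in> domF" for n
    unfolding z_def domF_cyl_of using kick[of n] p1[of n] p1[of "n + 1"] by simp
  have orbit: "is_orbit z" using F0_z domF_z by (simp add: is_orbit_def)
  have cone: "24 / 25 \<le> \<bar>cos (2 * fst q)\<bar>" if q: "cyl_of q = z n" for n q
  proof -
    obtain k :: int where k: "fst q = theta u n + of_int k * pi"
      using q by (auto simp: z_def cyl_of_def circ_of_eq_iff)
    have "cos (2 * fst q) = cos (2 * s_seq n + 2 * u n + 2 * pi * of_int k)"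
      by (simp add: k theta_def algebra_simps)
    also have "\<dots> = sigma n * cos (2 * u n)"
      using sin_s[of n] by (simp only: cos_add sin_int_2pin cos_int_2pin sigma_def) simp
    finally show ?thesis using cos_double_ge[OF u_le[of n]] sigma[of n] by (simp add: abs_mult)
  qed

  have p_left: "p n = drift_inv (u n - u (n - 1))" if "n \<le> 0" for n
    using that by (simp add: p theta_def s_seq_def)
  have p_right: "p (n + 1) = - drift_inv (u n - u (n + 1))" if "n \<ge> 1" for n
    using that drift_inv_minus[of "u n - u (n + 1)"] by (simp add: p theta_def s_seq_def)
  \<comment> \<open>reading \<open>u\<close> backwards from \<open>n \<le> 0\<close> gives a sequence at \<open>X\<close>, where \<open>cos (2\<theta>) = 1\<close>\<close>
  have seq_left: "local_seq 1 (\<lambda>k. u (n - int k))" if "n \<le> 0" for n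
    unfolding local_seq_def
  proof (intro conjI allI u_le)
    fix k
    define m where "m = n - int (Suc k)"
    have m: "m \<le> 0" "m + 1 \<le> 0" "n - int k = m + 1" "n - int (Suc (Suc k)) = m - 1"
      using that by (simp_all add: m_def)
    have "16 * sin (2 * u m) = p m - p (m + 1)"
      using kick[of m] m(1) by (simp add: theta_def s_seq_def)
    then show "drift_inv (u (n - int (Suc k)) - u (n - int (Suc (Suc k))))
        - drift_inv (u (n - int k) - u (n - int (Suc k))) = 16 * 1 * sin (2 * u (n - int (Suc k)))"
      using p_left[OF m(1)] p_left[OF m(2)] unfolding m(3,4) m_def[symmetric] by simp
  qed
  \<comment> \<open>reading \<open>u\<close> forwards from \<open>n \<ge> 1\<close> gives a sequence at \<open>Y\<close>, where \<open>cos (2\<theta>) = -1\<close>\<close>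
  have seq_right: "local_seq (-1) (\<lambda>k. u (n + int k))" if "n \<ge> 1" for n
    unfolding local_seq_def
  proof (intro conjI allI u_le)
    fix k
    define m where "m = n + int k"
    have m: "m \<ge> 1" "m + 1 \<ge> 1" "n + int (Suc k) = m + 1" "n + int (Suc (Suc k)) = m + 1 + 1"
      using that by (simp_all add: m_def)
    have "16 * (- sin (2 * u (m + 1))) = p (m + 1) - p (m + 1 + 1)"
      using kick[of "m + 1"] m(1) unfolding sin_theta by (simp add: sigma_def s_seq_def)
    then show "drift_inv (u (n + int (Suc k)) - u (n + int (Suc (Suc k))))
        - drift_inv (u (n + int k) - u (n + int (Suc k))) = 16 * (-1) * sin (2 * u (n + int (Suc k)))"
      using p_right[OF m(1)] p_right[OF m(2)] unfolding m(3,4) m_def[symmetric] by simp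
  qed

  have rev_z: "reversor (z n) = cyl_of (theta u n, - p (n + 1))" for n
    using kick[of n] by (simp add: z_def reversor_cyl_of reversor_lift_def)
  have z_left: "z n = cyl_of (graph_point 0 1 (u n))" if "n \<le> 0" for n
    using p_left[OF that] local_seq_backstep[OF _ seq_left[OF that], of 0] that
    by (simp add: z_def graph_point_def theta_def s_seq_def)
  have z_right: "reversor (z n) = cyl_of (graph_point (pi / 2) (-1) (u n))" if "n \<ge> 1" for n
    using p_right[OF that] local_seq_backstep[OF _ seq_right[OF that], of 0] that
    by (simp add: rev_z graph_point_def theta_def s_seq_def)

  have "(\<lambda>k. cyl_of (0 + u (0 - int k), drift_inv (u (0 - int k) - u (0 - int (Suc k))))) \<longlonglongrightarrow> cyl_of (0, 0)"
    by (rule local_seq_backward_orbit(3)[where c = 1, OF _ _ seq_left]) simp_all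
  moreover have "cyl_of (0 + u (0 - int k), drift_inv (u (0 - int k) - u (0 - int (Suc k)))) = z (0 - int k)" for k
  proof -
    have "0 - int (Suc k) = 0 - int k - 1" by simp
    then show ?thesis using p_left[of "0 - int k"] by (simp only: z_def theta_def) (simp add: s_seq_def)
  qed
  ultimately have lim_left: "(z \<longlongrightarrow> saddle_X) at_bot"
    unfolding saddle_X_def by (intro tendsto_at_bot_int[of z 0]) (simp only:)
  have rev_Y: "reversor saddle_Y = saddle_Y"
    by (simp add: saddle_Y_def reversor_cyl_of reversor_lift_def)
  have "(\<lambda>k. cyl_of (pi / 2 + u (1 + int k), drift_inv (u (1 + int k) - u (1 + int (Suc k))))) \<longlonglongrightarrow> cyl_of (pi / 2, 0)"
    by (rule local_seq_backward_orbit(3)[where c = "-1", OF _ _ seq_right]) simp_all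
  moreover have "cyl_of (pi / 2 + u (1 + int k), drift_inv (u (1 + int k) - u (1 + int (Suc k))))
      = reversor (z (1 + int k))" for k
  proof -
    have "1 + int (Suc k) = 1 + int k + 1" by simp
    then show ?thesis using p_right[of "1 + int k"] by (simp only: rev_z theta_def) (simp add: s_seq_def)
  qed
  ultimately have "(\<lambda>k. reversor (z (1 + int k))) \<longlonglongrightarrow> saddle_Y"
    unfolding saddle_Y_def by (simp only:)
  then have "(\<lambda>k. reversor (reversor (z (1 + int k)))) \<longlonglongrightarrow> reversor saddle_Y"
    by (rule continuous_on_tendsto_compose[OF continuous_on_reversor[of UNIV]]) auto
  then have lim_right: "(z \<longlongrightarrow> saddle_Y) at_top"
    unfolding rev_Y by (intro tendsto_at_top_int[of z 1]) simp

  have Wu: "z n \<in> Wu saddle_X" for n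
  proof -
    have "backward_orbit (z n) (\<lambda>k. z (n - int k))"
      unfolding backward_orbit_def using domF_z F0_z by simp
    moreover have "(\<lambda>k. z (n - int k)) \<longlonglongrightarrow> saddle_X"
      by (rule filterlim_compose[OF lim_left filterlim_int_minus_at_bot])
    ultimately show ?thesis unfolding Wu_def by blast
  qed
  have Ws: "z n \<in> Ws saddle_Y" for n
  proof -
    have "forward_orbit (z n) (\<lambda>k. z (n + int k))"
      unfolding forward_orbit_def using domF_z F0_z by (simp add: algebra_simps)
    moreover have "(\<lambda>k. z (n + int k)) \<longlonglongrightarrow> saddle_Y"
      by (rule filterlim_compose[OF lim_right filterlim_int_plus_at_top])
    ultimately show ?thesis unfolding Ws_def by blast
  qed

  have unstable: "\<exists>N. \<exists>L\<subseteq>unstable_cone. embedded_curve_tangent (Wu_part saddle_X (strip 0) N) (z n) L" for n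
  proof (rule unstable_curve_along_orbit[where m = 0, OF orbit cone])
    fix n :: int assume "n \<le> 0"
    then show "\<exists>L\<subseteq>unstable_cone. embedded_curve_tangent (Wu_part saddle_X (strip 0) 0) (z n) L"
      using local_unstable_curve[of 0 1 "u n"] u_less by (simp add: z_left saddle_X_def)
  qed
  \<comment> \<open>the time-reversed orbit leaves \<open>Y\<close>, and its unstable curve is the reversed stable curve of \<open>Y\<close>\<close>
  define y where "y n = reversor (z (- n))" for n
  have "is_orbit y"
    unfolding is_orbit_def
  proof (intro allI conjI)
    fix n
    show "y n \<in> domF" using domF_z by (simp add: y_def)
    show "F0 (y n) = y (n + 1)"
      using F0_reversor_F0[OF domF_z, of "- n - 1"] F0_z[of "- n - 1"] by (simp add: y_def)
  qed
  moreover have cone_y: "24 / 25 \<le> \<bar>cos (2 * fst q)\<bar>" if q: "cyl_of q = y n" for n q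
  proof -
    have "circ_of (fst q) = circ_of (theta u (- n))"
      using arg_cong[OF q, of fst] by (simp add: y_def rev_z)
    then have "cyl_of (fst q, p (- n)) = z (- n)" by (simp add: z_def cyl_of_def)
    from cone[OF this] show ?thesis by simp
  qed
  ultimately have stable_rev: "\<exists>N. \<exists>L\<subseteq>unstable_cone.
      embedded_curve_tangent (Wu_part saddle_Y (strip (pi / 2)) N) (y n) L" for n
  proof (rule unstable_curve_along_orbit[where m = "-1"])
    fix n :: int assume n: "n \<le> -1"
    show "\<exists>L\<subseteq>unstable_cone. embedded_curve_tangent (Wu_part saddle_Y (strip (pi / 2)) 0) (y n) L"
      using local_unstable_curve[of "pi / 2" "-1" "u (- n)"] u_less n
      by (simp add: y_def z_right saddle_Y_def)
  qed
  have strip_mem: "cyl_of (a, 0) \<in> strip a" for a unfolding strip_def by (intro imageI) auto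
  have transverse: "\<exists>L M. Wu_tangent saddle_X (z n) L \<and> Ws_tangent saddle_Y (z n) M \<and> L \<noteq> M" for n
  proof -
    obtain N L where L: "L \<subseteq> unstable_cone"
      "embedded_curve_tangent (Wu_part saddle_X (strip 0) N) (z n) L"
      using unstable by blast
    obtain N' L' where L': "L' \<subseteq> unstable_cone"
      "embedded_curve_tangent (Wu_part saddle_Y (strip (pi / 2)) N') (y (- n)) L'"
      using stable_rev by blast
    have "y (- n) \<in> domF" using \<open>is_orbit y\<close> by (simp add: is_orbit_def)
    from stable_curve_reversor[OF L'(2,1) this cone_y[where n = "- n"]]
    obtain M where M: "M \<subseteq> stable_cone"
      "embedded_curve_tangent (Ws_part saddle_Y (reversor ` strip (pi / 2)) N') (z n) M"
      by (auto simp: rev_Y y_def)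
    have "saddle_Y \<in> reversor ` strip (pi / 2)"
      using strip_mem[of "pi / 2"] rev_Y unfolding saddle_Y_def by (metis image_eqI)
    then have "Ws_tangent saddle_Y (z n) M"
      unfolding Ws_tangent_def using M(2) open_reversor_image[OF open_strip] by blast
    moreover have "Wu_tangent saddle_X (z n) L"
      unfolding Wu_tangent_def using L(2) open_strip strip_mem[of 0] unfolding saddle_X_def by blast
    ultimately show ?thesis using unstable_stable_lines_distinct[OF L(2,1) M(1)] by blast
  qed
  have "transverse_heteroclinic saddle_X saddle_Y z"
    unfolding transverse_heteroclinic_def using orbit lim_left lim_right Wu Ws transverse by blast
  then show ?thesis using orbit unfolding z_def[abs_def] by blast
qed

end
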